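(* Let $\varphi$ be a holomorphic self-map of the unit polydisk $\mathbb{D}^n$ and let $\psi\in\mathcal{B}(\mathbb{D}^n)$. Let $W_{\psi,\varphi}f=\psi\,(f\circ\varphi)$. Then $W_{\psi,\varphi}:H^\infty(\mathbb{D}^n)\to\mathcal{B}(\mathbb{D}^n)$ is compact if and only if $$\lim_{\varphi(z)\to\partial\mathbb{D}^n}Q_\psi(z)=0\quad\text{and}\quad\lim_{\varphi(z)\to\partial\mathbb{D}^n}|\psi(z)|\,\theta_\varphi(z)=0.$$
   Context: $\mathbb{D}^n=\{z\in\mathbb{C}^n:|z_k|<1,\ k=1,\dots,n\}$, with topological boundary $\partial\mathbb{D}^n$. $H(\mathbb{D}^n)$ is the set of holomorphic functions $\mathbb{D}^n\to\mathbb{C}$, and $H^\infty(\mathbb{D}^n)$ is the space of bounded ones with the supremum norm $\|\cdot\|_\infty$. Bergman metric: $H_z(u,\overline{v})=\sum_{j=1}^n\frac{u_j\overline{v_j}}{(1-|z_j|^2)^2}$. For $f\in H(\mathbb{D}^n)$, let $Q_f(z)=\sup_{u\in\mathbb{C}^n\setminus\{0\}}\frac{\left|\sum_{k=1}^n\frac{\partial f}{\partial z_k}(z)u_k\right|}{H_z(u,\overline{u})^{1/2}}$ and $\beta_f=\sup_{z\in\mathbb{D}^n}Q_f(z)$. The Bloch space $\mathcal{B}(\mathbb{D}^n)=\{f\in H(\mathbb{D}^n):\beta_f<\infty\}$ has norm $\|f\|_{\mathcal{B}}=|f(0)|+\beta_f$. $\theta_\varphi(z)=\sup\{Q_{f\circ\varphi}(z):f\in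 H^\infty(\mathbb{D}^n),\ \|f\|_\infty\le1\}$. $\lim_{\varphi(z)\to\partial\mathbb{D}^n}F(z)=0$ means: for each $\varepsilon>0$ there is a compact $K\subset\mathbb{D}^n$ such that $|F(z)|<\varepsilon$ for all $z\in\mathbb{D}^n$ with $\varphi(z)\notin K$ (vacuously true if $\varphi(\mathbb{D}^n)$ is relatively compact in $\mathbb{D}^n$).
   Formalization: The formal theorem additionally assumes that W_{ψ,φ} maps H^∞(D^n) into B(D^n); for ψ only in the Bloch space this can fail while both limits hold vacuously (φ(D^n) relatively compact), so the claim would be false without it. *)

theory Defs
  imports "HOL-Complex_Analysis.Complex_Analysis"
begin

unbundle no Formal_Power_Series.fps_syntax

definition polydisk :: "(complex^'n) set" where
  "polydisk = {z. \<forall>k. cmod (z $ k) < 1}"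

text \<open>Holomorphy in several variables: the total derivative exists and is complex linear.\<close>

definition holomorphic_polydisk :: "(complex^'n \<Rightarrow> complex) \<Rightarrow> bool" where
  "holomorphic_polydisk f \<longleftrightarrow>
     (\<forall>z\<in>polydisk. \<exists>L. (f has_derivative L) (at z) \<and> (\<forall>c v. L (c *s v) = c * L v))"

definition holomorphic_self_map :: "(complex^'n \<Rightarrow> complex^'n) \<Rightarrow> bool" where
  "holomorphic_self_map \<phi> \<longleftrightarrow>
     (\<forall>k. holomorphic_polydisk (\<lambda>z. \<phi> z $ k)) \<and> \<phi> ` polydisk \<subseteq> polydisk"

text \<open>A function on the polydisk is represented by its extension by \<open>0\<close>, so that equality of
  elements of the function spaces below is equality of functions on the polydisk.\<close>

definition hol :: "(complex^'n \<Rightarrow> complex) set" where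
  "hol = {f. holomorphic_polydisk f \<and> (\<forall>z. z \<notin> polydisk \<longrightarrow> f z = 0)}"

definition hinf :: "(complex^'n \<Rightarrow> complex) set" where
  "hinf = {f \<in> hol. bounded (f ` polydisk)}"

definition hinf_norm :: "(complex^'n \<Rightarrow> complex) \<Rightarrow> real" where
  "hinf_norm f = (SUP z\<in>polydisk. cmod (f z))"

definition partial_deriv :: "(complex^'n \<Rightarrow> complex) \<Rightarrow> 'n \<Rightarrow> complex^'n \<Rightarrow> complex" where
  "partial_deriv f k z = deriv (\<lambda>w. f (\<chi> j. if j = k then w else z $ j)) (z $ k)"

text \<open>\<open>bergman z u v\<close> is \<open>H\<^sub>z(u, cnj v)\<close>.\<close>

definition bergman :: "complex^'n \<Rightarrow> complex^'n \<Rightarrow> complex^'n \<Rightarrow> complex" where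
  "bergman z u v = (\<Sum>j\<in>UNIV. u $ j * cnj (v $ j) / (1 - of_real ((cmod (z $ j))\<^sup>2))\<^sup>2)"

text \<open>The supremum defining \<open>Q\<close> is finite at every point of the polydisk, and so is the one
  defining \<open>theta\<close> for a holomorphic self-map; see the lemmas \<open>bdd_above_Q\<close> and
  \<open>bdd_above_theta\<close>.\<close>

definition Q :: "(complex^'n \<Rightarrow> complex) \<Rightarrow> complex^'n \<Rightarrow> real" where
  "Q f z = (SUP u\<in>UNIV - {0}.
     cmod (\<Sum>k\<in>UNIV. partial_deriv f k z * u $ k) / sqrt (Re (bergman z u u)))"

definition bloch_beta :: "(complex^'n \<Rightarrow> complex) \<Rightarrow> real" where
  "bloch_beta f = (SUP z\<in>polydisk. Q f z)"

definition bloch :: "(complex^'n \<Rightarrow> complex) set" where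
  "bloch = {f \<in> hol. bdd_above (Q f ` polydisk)}"

definition bloch_norm :: "(complex^'n \<Rightarrow> complex) \<Rightarrow> real" where
  "bloch_norm f = cmod (f 0) + bloch_beta f"

definition theta :: "(complex^'n \<Rightarrow> complex^'n) \<Rightarrow> complex^'n \<Rightarrow> real" where
  "theta \<phi> z = (SUP f\<in>{f \<in> hinf. hinf_norm f \<le> 1}. Q (f \<circ> \<phi>) z)"

definition lim_to_boundary_zero ::
    "(complex^'n \<Rightarrow> complex^'n) \<Rightarrow> (complex^'n \<Rightarrow> real) \<Rightarrow> bool" where
  "lim_to_boundary_zero \<phi> F \<longleftrightarrow>
     (\<forall>\<epsilon>>0. \<exists>K. compact K \<and> K \<subseteq> polydisk \<and> (\<forall>z\<in>polydisk. \<phi> z \<notin> K \<longrightarrow> \<bar>F z\<bar> < \<epsilon>))"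

text \<open>For \<open>\<psi> \<in> hol\<close> this is again extended by \<open>0\<close>.\<close>

definition weighted_comp ::
    "(complex^'n \<Rightarrow> complex) \<Rightarrow> (complex^'n \<Rightarrow> complex^'n) \<Rightarrow>
     (complex^'n \<Rightarrow> complex) \<Rightarrow> complex^'n \<Rightarrow> complex" where
  "weighted_comp \<psi> \<phi> f = (\<lambda>z. \<psi> z * f (\<phi> z))"

text \<open>Compact linear operators between spaces \<open>V\<close>, \<open>W\<close> of complex-valued functions with norms
  \<open>nV\<close>, \<open>nW\<close>: bounded sets have relatively compact image in the norm topology of \<open>W\<close>.
  The locale \<open>Metric_space\<close> requires nonnegativity and symmetry of the distance outside the
  carrier as well, hence the conditional; it does not affect the topology.\<close>

definition norm_dist :: "('a \<Rightarrow> complex) set \<Rightarrow> (('a \<Rightarrow> complex) \<Rightarrow> real) \<Rightarrow>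
    ('a \<Rightarrow> complex) \<Rightarrow> ('a \<Rightarrow> complex) \<Rightarrow> real" where
  "norm_dist W nW f g = (if f \<in> W \<and> g \<in> W then nW (\<lambda>x. f x - g x) else 0)"

definition norm_topology :: "('a \<Rightarrow> complex) set \<Rightarrow> (('a \<Rightarrow> complex) \<Rightarrow> real) \<Rightarrow> ('a \<Rightarrow> complex) topology" where
  "norm_topology W nW = Metric_space.mtopology W (norm_dist W nW)"

definition compact_operator ::
    "('a \<Rightarrow> complex) set \<Rightarrow> (('a \<Rightarrow> complex) \<Rightarrow> real) \<Rightarrow>
     ('b \<Rightarrow> complex) set \<Rightarrow> (('b \<Rightarrow> complex) \<Rightarrow> real) \<Rightarrow>
     (('a \<Rightarrow> complex) \<Rightarrow> 'b \<Rightarrow> complex) \<Rightarrow> bool" where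
  "compact_operator V nV W nW T \<longleftrightarrow>
     T ` V \<subseteq> W \<and>
     (\<forall>f\<in>V. \<forall>g\<in>V. \<forall>c d. T (\<lambda>x. c * f x + d * g x) = (\<lambda>y. c * T f y + d * T g y)) \<and>
     (\<forall>S M. S \<subseteq> V \<and> (\<forall>f\<in>S. nV f \<le> M) \<longrightarrow>
        compactin (norm_topology W nW) (norm_topology W nW closure_of (T ` S)))"


lemma zero_in_polydisk: "0 \<in> polydisk"
  by (simp add: polydisk_def)

lemma open_polydisk: "open (polydisk :: (complex^'n) set)"
proof -
  have eq: "polydisk = (\<Inter>k. {z :: complex^'n. cmod (z $ k) < 1})"
    by (auto simp: polydisk_def)
  have "open {z :: complex^'n. cmod (z $ k) < 1}" for k
    by (intro open_Collect_less continuous_intros)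
  then show ?thesis unfolding eq by (intro open_INT) auto
qed

lemma convex_polydisk: "convex (polydisk :: (complex^'n) set)"
proof (rule convexI)
  fix x y :: "complex^'n" and u v :: real
  assume *: "x \<in> polydisk" "y \<in> polydisk" "0 \<le> u" "0 \<le> v" "u + v = 1"
  have "cmod ((u *\<^sub>R x + v *\<^sub>R y) $ k) < 1" for k
    using convexD[OF convex_ball[of "0 :: complex" 1], of "x $ k" "y $ k" u v] *
    by (simp add: polydisk_def)
  then show "u *\<^sub>R x + v *\<^sub>R y \<in> polydisk" by (simp add: polydisk_def)
qed

lemma Re_bergman:
  "Re (bergman z u u) = (\<Sum>j\<in>UNIV. (cmod (u $ j))\<^sup>2 / (1 - (cmod (z $ j))\<^sup>2)\<^sup>2)"
proof -
  have "u $ j * cnj (u $ j) / (1 - of_real ((cmod (z $ j))\<^sup>2))\<^sup>2 =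
      of_real ((cmod (u $ j))\<^sup>2 / (1 - (cmod (z $ j))\<^sup>2)\<^sup>2)" for j
    unfolding complex_norm_square[symmetric] by (simp only: of_real_divide of_real_power of_real_diff of_real_1)
  then have "bergman z u u = of_real (\<Sum>j\<in>UNIV. (cmod (u $ j))\<^sup>2 / (1 - (cmod (z $ j))\<^sup>2)\<^sup>2)"
    unfolding bergman_def by (simp only: of_real_sum)
  then show ?thesis by (simp only: Re_complex_of_real)
qed

lemma cmod_le_bergman:
  assumes "z \<in> polydisk"
  shows "cmod (u $ k) \<le> sqrt (Re (bergman z u u))"
proof -
  have lt: "(cmod (z $ k))\<^sup>2 < 1" using assms
    by (simp add: polydisk_def power_less_one_iff abs_square_less_1)
  then have "(cmod (u $ k))\<^sup>2 * (1 - (cmod (z $ k))\<^sup>2)\<^sup>2 \<le> (cmod (u $ k))\<^sup>2 * 1"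
    by (intro mult_left_mono power_le_one) auto
  with lt have "(cmod (u $ k))\<^sup>2 \<le> (cmod (u $ k))\<^sup>2 / (1 - (cmod (z $ k))\<^sup>2)\<^sup>2"
    by (simp add: pos_le_divide_eq)
  also have "\<dots> \<le> Re (bergman z u u)"
    unfolding Re_bergman by (rule member_le_sum) auto
  finally show ?thesis by (simp add: real_le_rsqrt)
qed

lemma bergman_pos:
  assumes "z \<in> polydisk" "u \<noteq> 0"
  shows "sqrt (Re (bergman z u u)) > 0"
proof -
  from assms(2) obtain k where "u $ k \<noteq> 0" by (auto simp: vec_eq_iff)
  then show ?thesis using cmod_le_bergman[OF assms(1), of u k]
    by (metis less_le_trans zero_less_norm_iff)
qed

lemma Q_quotient_le:
  assumes "z \<in> polydisk" "u \<noteq> 0"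
  shows "cmod (\<Sum>k\<in>UNIV. partial_deriv f k z * u $ k) / sqrt (Re (bergman z u u))
       \<le> (\<Sum>k\<in>UNIV. cmod (partial_deriv f k z))"
proof -
  have "cmod (\<Sum>k\<in>UNIV. partial_deriv f k z * u $ k)
      \<le> (\<Sum>k\<in>UNIV. cmod (partial_deriv f k z) * sqrt (Re (bergman z u u)))"
    by (rule order_trans[OF norm_sum], rule sum_mono)
       (simp add: norm_mult mult_left_mono cmod_le_bergman assms)
  then show ?thesis using bergman_pos[OF assms]
    by (simp add: pos_divide_le_eq sum_distrib_right)
qed

lemma bdd_above_Q:
  assumes "z \<in> polydisk"
  shows "bdd_above ((\<lambda>u. cmod (\<Sum>k\<in>UNIV. partial_deriv f k z * u $ k)
    / sqrt (Re (bergman z u u))) ` (UNIV - {0}))"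
  using Q_quotient_le[OF assms] by (intro bdd_aboveI2) auto

lemma nonzero_vec: "UNIV - {0 :: complex^'n} \<noteq> {}"
proof -
  have "(\<chi> j. 1) \<noteq> (0 :: complex^'n)" by (simp add: vec_eq_iff)
  then show ?thesis by blast
qed

lemma Q_le_sum:
  fixes z :: "complex^'n"
  assumes "z \<in> polydisk"
  shows "Q f z \<le> (\<Sum>k\<in>UNIV. cmod (partial_deriv f k z))"
  unfolding Q_def using Q_quotient_le[OF assms] nonzero_vec by (intro cSUP_least) auto

lemma Q_upper:
  assumes "z \<in> polydisk" "u \<noteq> 0"
  shows "cmod (\<Sum>k\<in>UNIV. partial_deriv f k z * u $ k) / sqrt (Re (bergman z u u)) \<le> Q f z"
  unfolding Q_def using assms by (intro cSUP_upper bdd_above_Q) auto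

lemma Q_nonneg:
  fixes z :: "complex^'n"
  assumes "z \<in> polydisk"
  shows "0 \<le> Q f z"
proof -
  obtain u :: "complex^'n" where "u \<noteq> 0" using nonzero_vec by blast
  have "0 \<le> cmod (\<Sum>k\<in>UNIV. partial_deriv f k z * u $ k) / sqrt (Re (bergman z u u))"
    using bergman_pos[OF assms \<open>u \<noteq> 0\<close>] by simp
  then show ?thesis using Q_upper[OF assms \<open>u \<noteq> 0\<close>] by (rule order_trans)
qed

lemma slice_eq: "((\<chi> j. if j = k then w else z $ j) :: complex^'n) = z + (w - z $ k) *s axis k 1"
  by (auto simp: vec_eq_iff axis_def)

lemma slice_has_derivative:
  "((\<lambda>w. (\<chi> j. if j = k then w else z $ j) :: complex^'n) has_derivative
     (\<lambda>h. h *s axis k 1)) (at w)"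
proof -
  have "bounded_linear (\<lambda>h. h *s axis k 1 :: complex^'n)"
    by (rule linear_conv_bounded_linear[THEN iffD1], rule linearI)
       (auto simp: vec_eq_iff axis_def)
  moreover have "((\<lambda>w. w - z $ k) has_derivative (\<lambda>h. h)) (at w)"
    by (auto intro!: derivative_eq_intros)
  ultimately have "((\<lambda>w. (w - z $ k) *s axis k 1 :: complex^'n) has_derivative (\<lambda>h. h *s axis k 1)) (at w)"
    by (rule bounded_linear.has_derivative)
  from has_derivative_add[OF has_derivative_const[of z] this]
  show ?thesis unfolding slice_eq by (simp only: add_0_left)
qed

lemma slice_has_field_derivative:
  assumes f: "(f has_derivative L) (at ((\<chi> j. if j = k then w else z $ j) :: complex^'n))"
    and L: "\<And>c v. L (c *s v) = c * L v"
  shows "((\<lambda>w. f (\<chi> j. if j = k then w else z $ j)) has_field_derivative L (axis k 1)) (at w)"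
proof -
  have "((\<lambda>w. f (\<chi> j. if j = k then w else z $ j)) has_derivative (\<lambda>h. L (h *s axis k 1))) (at w)"
    by (rule has_derivative_compose[OF slice_has_derivative f])
  then show ?thesis unfolding has_field_derivative_def L by (simp add: mult.commute[of _ "L _"])
qed

lemma partial_deriv_eq:
  assumes "(f has_derivative L) (at z)" "\<And>c v. L (c *s v) = c * L v"
  shows "partial_deriv f k z = L (axis k 1)"
  unfolding partial_deriv_def
proof (rule DERIV_imp_deriv, rule slice_has_field_derivative)
  have "(\<chi> j. if j = k then z $ k else z $ j) = z" by (simp add: vec_eq_iff)
  then show "(f has_derivative L) (at (\<chi> j. if j = k then z $ k else z $ j))" using assms(1) by simp
qed (rule assms(2))

lemma has_derivative_partial_deriv:
  assumes "holomorphic_polydisk f" "z \<in> polydisk"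
  shows "(f has_derivative (\<lambda>u. \<Sum>k\<in>UNIV. partial_deriv f k z * u $ k)) (at z)"
proof -
  obtain L where L: "(f has_derivative L) (at z)" "\<And>c v. L (c *s v) = c * L v"
    using assms unfolding holomorphic_polydisk_def by blast
  have "L = (\<lambda>u. \<Sum>k\<in>UNIV. partial_deriv f k z * u $ k)"
  proof
    fix u
    have lin: "linear L" using L(1) by (rule has_derivative_linear)
    have "L u = L (\<Sum>k\<in>UNIV. u $ k *s axis k 1)" by (simp add: basis_expansion)
    also have "\<dots> = (\<Sum>k\<in>UNIV. partial_deriv f k z * u $ k)"
      by (simp add: linear_sum[OF lin] L(2) partial_deriv_eq[OF L] mult.commute)
    finally show "L u = (\<Sum>k\<in>UNIV. partial_deriv f k z * u $ k)" .
  qed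
  with L(1) show ?thesis by simp
qed

lemma holomorphic_polydisk_iff:
  "holomorphic_polydisk f \<longleftrightarrow>
    (\<forall>z\<in>polydisk. (f has_derivative (\<lambda>u. \<Sum>k\<in>UNIV. partial_deriv f k z * u $ k)) (at z))"
proof
  assume "\<forall>z\<in>polydisk. (f has_derivative (\<lambda>u. \<Sum>k\<in>UNIV. partial_deriv f k z * u $ k)) (at z)"
  then show "holomorphic_polydisk f"
    unfolding holomorphic_polydisk_def
    by (intro ballI exI conjI) (auto simp: sum_distrib_left mult_ac)
qed (auto intro: has_derivative_partial_deriv)

lemma holomorphic_polydisk_lincomb:
  fixes f g :: "complex^'n \<Rightarrow> complex"
  assumes "holomorphic_polydisk f" "holomorphic_polydisk g"
  shows "holomorphic_polydisk (\<lambda>z. c * f z + d * g z)"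
    and "z \<in> polydisk \<Longrightarrow> partial_deriv (\<lambda>z. c * f z + d * g z) k z
      = c * partial_deriv f k z + d * partial_deriv g k z"
proof -
  have *: "\<exists>L. ((\<lambda>z. c * f z + d * g z) has_derivative L) (at z) \<and> (\<forall>c v. L (c *s v) = c * L v)
      \<and> L (axis k 1) = c * partial_deriv f k z + d * partial_deriv g k z"
    if z: "z \<in> polydisk" for z :: "complex^'n" and k
  proof -
    obtain L where L: "(f has_derivative L) (at z)" "\<And>c v. L (c *s v) = c * L v"
      using assms z unfolding holomorphic_polydisk_def by blast
    obtain M where M: "(g has_derivative M) (at z)" "\<And>c v. M (c *s v) = c * M v"
      using assms z unfolding holomorphic_polydisk_def by blast
    show ?thesis
      by (rule exI[of _ "\<lambda>u. c * L u + d * M u"])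
         (auto intro!: derivative_eq_intros L M
           simp: L(2) M(2) partial_deriv_eq[OF L] partial_deriv_eq[OF M] algebra_simps)
  qed
  show "holomorphic_polydisk (\<lambda>z. c * f z + d * g z)"
    unfolding holomorphic_polydisk_def using * by blast
  show "z \<in> polydisk \<Longrightarrow> partial_deriv (\<lambda>z. c * f z + d * g z) k z
      = c * partial_deriv f k z + d * partial_deriv g k z"
    (is "_ \<Longrightarrow> ?l = ?r")
  proof -
    assume "z \<in> polydisk"
    from *[OF this, of k] obtain L where
      L: "((\<lambda>z. c * f z + d * g z) has_derivative L) (at z)" "\<And>c v. L (c *s v) = c * L v"
        "L (axis k 1) = ?r" by blast
    show "?l = ?r" using partial_deriv_eq[OF L(1,2), of k] L(3) by (rule trans)
  qed
qed

lemma partial_deriv_comp_le: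
  fixes z :: "complex^'n"
  assumes \<phi>: "holomorphic_self_map \<phi>" and f: "f \<in> hinf" "hinf_norm f \<le> 1" and z: "z \<in> polydisk"
  shows "cmod (partial_deriv (f \<circ> \<phi>) k z) \<le> 2 / (1 - cmod (z $ k))"
proof -
  define g where "g = (\<lambda>w. (f \<circ> \<phi>) (\<chi> j. if j = k then w else z $ j))"
  define r where "r = (1 - cmod (z $ k)) / 2"
  have r: "r > 0" using z by (simp add: r_def polydisk_def)
  have mem: "(\<chi> j. if j = k then w else z $ j) \<in> polydisk" if "w \<in> cball (z $ k) r" for w
  proof -
    have "cmod w \<le> cmod (z $ k) + cmod (w - z $ k)" by (metis norm_triangle_sub)
    also have "\<dots> < 1"
    proof -
      have "cmod (w - z $ k) \<le> r" using that by (simp add: dist_norm norm_minus_commute)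
      moreover have "cmod (z $ k) < 1" using z by (simp add: polydisk_def)
      ultimately show ?thesis by (simp add: r_def field_simps)
    qed
    finally show ?thesis using z by (simp add: polydisk_def)
  qed
  have hd: "g field_differentiable at w" if "w \<in> cball (z $ k) r" for w
  proof -
    let ?p = "(\<chi> j. if j = k then w else z $ j) :: complex^'n"
    have p: "?p \<in> polydisk" by (rule mem[OF that])
    have "\<forall>i. \<exists>L. ((\<lambda>z. \<phi> z $ i) has_derivative L) (at ?p) \<and> (\<forall>c v. L (c *s v) = c * L v)"
      using \<phi> p unfolding holomorphic_self_map_def holomorphic_polydisk_def by blast
    then obtain L where L: "\<And>i. ((\<lambda>z. \<phi> z $ i) has_derivative L i) (at ?p)"
      "\<And>i c v. L i (c *s v) = c * L i v" by metis
    have "(\<phi> has_derivative (\<lambda>h. \<chi> i. L i h)) (at ?p)"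
      unfolding has_derivative_componentwise_within[of \<phi>]
    proof (rule ballI)
      fix b :: "complex^'n" assume "b \<in> Basis"
      then obtain i c where b: "b = axis i c" "c \<in> Basis" by (auto simp: Basis_vec_def)
      show "((\<lambda>x. \<phi> x \<bullet> b) has_derivative (\<lambda>x. (\<chi> i. L i x) \<bullet> b)) (at ?p)"
        unfolding b inner_axis using has_derivative_inner_left[OF L(1)] by simp
    qed
    moreover have "\<phi> ?p \<in> polydisk" using \<phi> p by (auto simp: holomorphic_self_map_def)
    then obtain M where M: "(f has_derivative M) (at (\<phi> ?p))" "\<And>c v. M (c *s v) = c * M v"
      using f unfolding hinf_def hol_def holomorphic_polydisk_def by blast
    ultimately have "((\<lambda>z. f (\<phi> z)) has_derivative (\<lambda>h. M (\<chi> i. L i h))) (at ?p)"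
      using has_derivative_compose[of \<phi> "\<lambda>h. \<chi> i. L i h" ?p UNIV f M] by simp
    moreover have "M (\<chi> i. L i (c *s v)) = c * M (\<chi> i. L i v)" for c v
    proof -
      have "(\<chi> i. L i (c *s v)) = c *s (\<chi> i. L i v)" by (simp add: vec_eq_iff L(2))
      then show ?thesis by (simp add: M(2))
    qed
    ultimately have "(g has_field_derivative M (\<chi> i. L i (axis k 1))) (at w)"
      unfolding g_def o_def by (rule slice_has_field_derivative)
    then show ?thesis by (auto simp: field_differentiable_def)
  qed
  have bd: "cmod (g w) \<le> 1" if "w \<in> cball (z $ k) r" for w
  proof -
    have "\<phi> (\<chi> j. if j = k then w else z $ j) \<in> polydisk"
      using \<phi> mem[OF that] by (auto simp: holomorphic_self_map_def)
    moreover have "bdd_above ((\<lambda>z. cmod (f z)) ` polydisk)"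
      using f(1) by (auto simp: hinf_def bounded_iff bdd_above_def)
    ultimately show ?thesis
      using f(2) unfolding hinf_norm_def g_def o_def by (meson cSUP_upper order_trans)
  qed
  have "cmod ((deriv ^^ 1) g (z $ k)) \<le> fact 1 * 1 / r ^ 1"
  proof (rule Cauchy_inequality[OF _ _ r])
    have hd': "g field_differentiable at w" if "w \<in> ball (z $ k) r" for w
      using that by (intro hd) simp
    show "g holomorphic_on ball (z $ k) r"
      unfolding holomorphic_on_def
      by (rule ballI, rule field_differentiable_at_within, rule hd')
    show "continuous_on (cball (z $ k) r) g"
      by (intro continuous_at_imp_continuous_on ballI field_differentiable_imp_continuous_at hd)
    show "cmod (g x) \<le> 1" if "cmod (z $ k - x) = r" for x
      using that by (intro bd) (simp add: dist_norm)
  qed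
  then show ?thesis by (simp add: partial_deriv_def g_def r_def)
qed

lemma bdd_above_theta:
  fixes z :: "complex^'n"
  assumes "holomorphic_self_map \<phi>" "z \<in> polydisk"
  shows "bdd_above ((\<lambda>f. Q (f \<circ> \<phi>) z) ` {f \<in> hinf. hinf_norm f \<le> 1})"
proof (rule bdd_aboveI2)
  fix f :: "complex^'n \<Rightarrow> complex" assume "f \<in> {f \<in> hinf. hinf_norm f \<le> 1}"
  then show "Q (f \<circ> \<phi>) z \<le> (\<Sum>k\<in>UNIV. 2 / (1 - cmod (z $ k)))"
    using partial_deriv_comp_le[OF assms(1) _ _ assms(2)]
    by (intro order_trans[OF Q_le_sum[OF assms(2)]] sum_mono) auto
qed

lemma Q_diff_le:
  fixes z :: "complex^'n"
  assumes "holomorphic_polydisk f" "holomorphic_polydisk g" "z \<in> polydisk"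
  shows "Q (\<lambda>z. f z - g z) z \<le> Q f z + Q g z"
  unfolding Q_def[of "\<lambda>z. f z - g z"]
proof (rule cSUP_least[OF nonzero_vec])
  fix u :: "complex^'n" assume "u \<in> UNIV - {0}"
  then have u: "u \<noteq> 0" by simp
  have "partial_deriv (\<lambda>z. f z - g z) k z = partial_deriv f k z - partial_deriv g k z" for k
    using holomorphic_polydisk_lincomb(2)[OF assms, of 1 "-1" k] by simp
  then have "cmod (\<Sum>k\<in>UNIV. partial_deriv (\<lambda>z. f z - g z) k z * u $ k)
      \<le> cmod (\<Sum>k\<in>UNIV. partial_deriv f k z * u $ k) + cmod (\<Sum>k\<in>UNIV. partial_deriv g k z * u $ k)"
    by (simp add: left_diff_distrib sum_subtractf norm_triangle_ineq4)
  then have "cmod (\<Sum>k\<in>UNIV. partial_deriv (\<lambda>z. f z - g z) k z * u $ k) / sqrt (Re (bergman z u u))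
      \<le> cmod (\<Sum>k\<in>UNIV. partial_deriv f k z * u $ k) / sqrt (Re (bergman z u u))
       + cmod (\<Sum>k\<in>UNIV. partial_deriv g k z * u $ k) / sqrt (Re (bergman z u u))"
    using bergman_pos[OF assms(3) u] by (simp add: divide_right_mono flip: add_divide_distrib)
  also have "\<dots> \<le> Q f z + Q g z"
    by (intro add_mono Q_upper assms u)
  finally show "cmod (\<Sum>k\<in>UNIV. partial_deriv (\<lambda>z. f z - g z) k z * u $ k)
    / sqrt (Re (bergman z u u)) \<le> Q f z + Q g z" .
qed

lemma hol_diff:
  assumes "f \<in> hol" "g \<in> hol"
  shows "(\<lambda>z. f z - g z) \<in> hol"
  using assms holomorphic_polydisk_lincomb(1)[of f g 1 "-1"] by (auto simp: hol_def)

lemma bloch_diff: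
  assumes "f \<in> bloch" "g \<in> bloch"
  shows "(\<lambda>z. f z - g z) \<in> bloch" and "bloch_norm (\<lambda>z. f z - g z) \<le> bloch_norm f + bloch_norm g"
proof -
  have f: "f \<in> hol" "bdd_above (Q f ` polydisk)" and g: "g \<in> hol" "bdd_above (Q g ` polydisk)"
    using assms by (auto simp: bloch_def)
  have le: "Q (\<lambda>z. f z - g z) z \<le> bloch_beta f + bloch_beta g" if "z \<in> polydisk" for z
  proof -
    have "Q (\<lambda>z. f z - g z) z \<le> Q f z + Q g z"
      using f g that by (intro Q_diff_le) (auto simp: hol_def)
    also have "\<dots> \<le> bloch_beta f + bloch_beta g"
      unfolding bloch_beta_def using f g that by (intro add_mono cSUP_upper)
    finally show ?thesis .
  qed
  then show "(\<lambda>z. f z - g z) \<in> bloch"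
    unfolding bloch_def using hol_diff[OF f(1) g(1)] by (auto intro!: bdd_aboveI2)
  have "bloch_beta (\<lambda>z. f z - g z) \<le> bloch_beta f + bloch_beta g"
    unfolding bloch_beta_def[of "\<lambda>z. f z - g z"]
    using zero_in_polydisk le by (intro cSUP_least) auto
  then show "bloch_norm (\<lambda>z. f z - g z) \<le> bloch_norm f + bloch_norm g"
    using norm_triangle_ineq4[of "f 0" "g 0"] by (simp add: bloch_norm_def)
qed

lemma bloch_beta_nonneg: 
  assumes "f \<in> bloch"
  shows "0 \<le> bloch_beta f"
  unfolding bloch_beta_def using assms Q_nonneg zero_in_polydisk
  by (auto simp: bloch_def intro!: cSUP_upper2[of _ _ 0])

lemma partial_deriv_minus: "partial_deriv (\<lambda>z. - f z) k z = - partial_deriv f k z"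
  if "holomorphic_polydisk f" "z \<in> polydisk"
  using holomorphic_polydisk_lincomb(2)[OF that(1) that(1) that(2), of "-1" 0 k] by simp

lemma bloch_norm_minus:
  assumes "f \<in> hol"
  shows "bloch_norm (\<lambda>z. - f z) = bloch_norm f"
proof -
  have "Q (\<lambda>z. - f z) z = Q f z" if "z \<in> polydisk" for z
    using assms that by (simp add: Q_def hol_def partial_deriv_minus sum_negf)
  then show ?thesis by (simp add: bloch_norm_def bloch_beta_def)
qed

lemma bloch_norm_eq_0:
  assumes "f \<in> bloch" "bloch_norm f = 0"
  shows "f = (\<lambda>z. 0)"
proof -
  have f: "f \<in> hol" "bdd_above (Q f ` polydisk)" using assms by (auto simp: bloch_def)
  have 0: "f 0 = 0" "bloch_beta f = 0"
    using assms(2) bloch_beta_nonneg[OF assms(1)] norm_ge_zero[of "f 0"]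
    unfolding bloch_norm_def by (simp_all add: add_nonneg_eq_0_iff)
  have der: "(f has_derivative (\<lambda>h. 0)) (at z)" if z: "z \<in> polydisk" for z
  proof -
    have "Q f z \<le> 0" using 0(2) f(2) z unfolding bloch_beta_def by (metis cSUP_upper)
    have "(\<Sum>k\<in>UNIV. partial_deriv f k z * u $ k) = 0" for u
    proof (cases "u = 0")
      case False
      have "cmod (\<Sum>k\<in>UNIV. partial_deriv f k z * u $ k) / sqrt (Re (bergman z u u)) \<le> 0"
        using Q_upper[OF z False, of f] \<open>Q f z \<le> 0\<close> by linarith
      then show ?thesis using bergman_pos[OF z False] by (simp add: divide_le_0_iff)
    qed simp
    then show ?thesis using has_derivative_partial_deriv[of f z] f(1) z by (simp add: hol_def)
  qed
  have "f z = 0" for z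
  proof (cases "z \<in> polydisk")
    case True
    have "f z = f 0"
      by (rule has_derivative_zero_unique[OF convex_polydisk _ True zero_in_polydisk])
         (auto intro: has_derivative_at_withinI der)
    with 0 show ?thesis by simp
  next
    case False
    with f(1) show ?thesis by (simp add: hol_def)
  qed
  then show ?thesis by auto
qed

lemma Metric_space_bloch: "Metric_space bloch (norm_dist bloch bloch_norm)"
proof
  fix f g h :: "complex^'n \<Rightarrow> complex"
  show "0 \<le> norm_dist bloch bloch_norm f g"
    using bloch_beta_nonneg[OF bloch_diff(1)[of f g]] by (simp add: norm_dist_def bloch_norm_def)
  show "norm_dist bloch bloch_norm f g = norm_dist bloch bloch_norm g f"
    using bloch_norm_minus[of "\<lambda>z. f z - g z"] hol_diff[of f g]
    by (auto simp: norm_dist_def bloch_def)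
  assume f: "f \<in> bloch" and g: "g \<in> bloch"
  show "norm_dist bloch bloch_norm f g = 0 \<longleftrightarrow> f = g"
  proof
    assume "norm_dist bloch bloch_norm f g = 0"
    then have "(\<lambda>z. f z - g z) = (\<lambda>z. 0)"
      using f g by (intro bloch_norm_eq_0 bloch_diff) (auto simp: norm_dist_def)
    then show "f = g" by (simp add: fun_eq_iff)
  next
    assume "f = g"
    have "bloch_norm (\<lambda>z :: complex^'n. 0) = 0"
    proof -
      have "Q (\<lambda>z :: complex^'n. 0) z = 0" for z
        by (simp add: Q_def partial_deriv_def cSUP_const[OF nonzero_vec])
      moreover have "polydisk \<noteq> ({} :: (complex^'n) set)" using zero_in_polydisk by blast
      ultimately show ?thesis by (simp add: bloch_norm_def bloch_beta_def)
    qed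
    with \<open>f = g\<close> show "norm_dist bloch bloch_norm f g = 0" by (simp add: norm_dist_def)
  qed
  assume h: "h \<in> bloch"
  have "bloch_norm (\<lambda>z. (f z - g z) - (h z - g z))
      \<le> bloch_norm (\<lambda>z. f z - g z) + bloch_norm (\<lambda>z. h z - g z)"
    by (intro bloch_diff(2) bloch_diff(1) f g h)
  moreover have "bloch_norm (\<lambda>z. h z - g z) = bloch_norm (\<lambda>z. g z - h z)"
    using bloch_norm_minus[of "\<lambda>z. g z - h z"] hol_diff[of g h] g h by (simp add: bloch_def)
  ultimately show "norm_dist bloch bloch_norm f h
      \<le> norm_dist bloch bloch_norm f g + norm_dist bloch bloch_norm g h"
    using f g h by (simp add: norm_dist_def)
qed

end

theory Submission
  imports Defs
begin

text \<open>
  Both limits together say that \<open>Q (\<psi> * (g \<circ> \<phi>)) z\<close> is small, uniformly over the unit ball of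
  \<open>H\<^sup>\<infinity>\<close>, when \<open>\<phi> z\<close> is close to the boundary.

  If this fails along points \<open>z\<^sub>m\<close> and functions \<open>g\<^sub>m\<close>, some coordinate \<open>a\<^sub>m\<close> of \<open>\<phi> z\<^sub>m\<close> has modulus
  tending to \<open>1\<close>. Multiplying \<open>g\<^sub>m\<close> by a function of that coordinate which equals \<open>1\<close> to second order
  at \<open>a\<^sub>m\<close>, is bounded by \<open>8\<close> and tends to \<open>0\<close> pointwise changes neither the value nor the
  derivative at \<open>\<phi> z\<^sub>m\<close>; but compactness forces the images of the products to \<open>0\<close> in Bloch norm.

  Conversely, by Montel's theorem it suffices to treat bounded sequences \<open>g\<^sub>m\<close> that converge to \<open>0\<close> locally
  uniformly. Where \<open>\<phi> z\<close> is near the boundary the limits apply. Where \<open>\<phi> z\<close> stays in a compact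
  set, the Cauchy estimates apply, because \<open>\<psi> * \<phi>\<^sub>j\<close>, the image of a coordinate function, lies in the
  Bloch space, which bounds \<open>\<bar>\<psi> z\<bar> * Q \<phi>\<^sub>j z\<close>.
\<close>

subsection \<open>Directional derivatives\<close>

text \<open>The numerator in \<open>Q\<close> without the modulus, named so that the product and
  chain rules can be stated free of coordinates.\<close>

definition dir_deriv :: "(complex^'n \<Rightarrow> complex) \<Rightarrow> complex^'n \<Rightarrow> complex^'n \<Rightarrow> complex" where
  "dir_deriv f z u = (\<Sum>k\<in>UNIV. partial_deriv f k z * u $ k)"

lemma dir_deriv_scale: "dir_deriv f z (c *s u) = c * dir_deriv f z u"
  by (simp add: dir_deriv_def sum_distrib_left mult_ac)

lemma has_derivative_dir_deriv:
  "holomorphic_polydisk f \<Longrightarrow> z \<in> polydisk \<Longrightarrow> (f has_derivative dir_deriv f z) (at z)"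
  using has_derivative_partial_deriv[of f z] by (simp add: dir_deriv_def[abs_def])

text \<open>A complex-linear map is determined by its values on the coordinate axes, and
  \<open>partial_deriv_eq\<close> identifies those. Hence any complex-linear derivative found by
  other rules computes \<open>dir_deriv\<close>.\<close>

lemma dir_deriv_eq:
  fixes u :: "complex^'n"
  assumes L: "(f has_derivative L) (at z)" "\<And>c v. L (c *s v) = c * L v"
  shows "dir_deriv f z u = L u"
proof -
  have "L u = L (\<Sum>k\<in>UNIV. u $ k *s axis k 1)" by (simp add: basis_expansion)
  also have "\<dots> = dir_deriv f z u"
    by (simp add: linear_sum[OF has_derivative_linear[OF L(1)]] L(2) partial_deriv_eq[OF L]
        dir_deriv_def mult.commute)
  finally show ?thesis by simp
qed

lemma norm_dir_deriv_le:
  "cmod (dir_deriv f z u) \<le> (\<Sum>k\<in>UNIV. cmod (partial_deriv f k z)) * norm u"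
  unfolding dir_deriv_def sum_distrib_right
  by (intro order_trans[OF norm_sum] sum_mono)
     (simp add: norm_mult mult_left_mono Finite_Cartesian_Product.norm_nth_le)

text \<open>Derivatives are local and the polydisk is open, so values outside it do not matter. This
  permits passing between a formula and its extension by 0.\<close>

lemma
  assumes "\<And>z. z \<in> polydisk \<Longrightarrow> f z = g z" and g: "holomorphic_polydisk g"
  shows holomorphic_polydisk_cong: "holomorphic_polydisk f"
    and dir_deriv_cong: "z \<in> polydisk \<Longrightarrow> dir_deriv f z u = dir_deriv g z u"
proof -
  have *: "(f has_derivative dir_deriv g z) (at z)" if z: "z \<in> polydisk" for z
    by (rule has_derivative_transform_within_open[OF has_derivative_dir_deriv[OF g z] open_polydisk z])
       (simp add: assms(1))
  then show "holomorphic_polydisk f"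
    unfolding holomorphic_polydisk_def using dir_deriv_scale by blast
  show "z \<in> polydisk \<Longrightarrow> dir_deriv f z u = dir_deriv g z u"
    by (rule dir_deriv_eq[OF *], assumption, rule dir_deriv_scale)
qed

lemma
  fixes f g :: "complex^'n \<Rightarrow> complex"
  assumes "holomorphic_polydisk f" "holomorphic_polydisk g"
  shows holomorphic_polydisk_mult: "holomorphic_polydisk (\<lambda>z. f z * g z)"
    and dir_deriv_mult: "z \<in> polydisk \<Longrightarrow>
      dir_deriv (\<lambda>z. f z * g z) z u = f z * dir_deriv g z u + dir_deriv f z u * g z"
proof -
  let ?L = "\<lambda>z u. f z * dir_deriv g z u + dir_deriv f z u * g z"
  have *: "((\<lambda>z. f z * g z) has_derivative ?L z) (at z)" if z: "z \<in> polydisk" for z :: "complex^'n"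
    using assms z by (intro has_derivative_mult has_derivative_dir_deriv)
  have sc: "?L z (c *s u) = c * ?L z u" for z u c by (simp add: dir_deriv_scale algebra_simps)
  show "holomorphic_polydisk (\<lambda>z. f z * g z)"
    unfolding holomorphic_polydisk_def using * sc by blast
  show "z \<in> polydisk \<Longrightarrow> dir_deriv (\<lambda>z. f z * g z) z u = ?L z u"
    by (rule dir_deriv_eq[OF *], assumption, rule sc)
qed

lemma
  fixes f :: "complex^'n \<Rightarrow> complex" and \<phi> :: "complex^'n \<Rightarrow> complex^'n"
  assumes f: "holomorphic_polydisk f" and \<phi>: "holomorphic_self_map \<phi>"
  shows holomorphic_polydisk_comp: "holomorphic_polydisk (\<lambda>z. f (\<phi> z))"
    and dir_deriv_comp: "z \<in> polydisk \<Longrightarrow>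
      dir_deriv (\<lambda>z. f (\<phi> z)) z u = dir_deriv f (\<phi> z) (\<chi> i. dir_deriv (\<lambda>z. \<phi> z $ i) z u)"
proof -
  let ?L = "\<lambda>z u. dir_deriv f (\<phi> z) (\<chi> i. dir_deriv (\<lambda>z. \<phi> z $ i) z u)"
  have *: "((\<lambda>z. f (\<phi> z)) has_derivative ?L z) (at z)" if z: "z \<in> polydisk" for z :: "complex^'n"
  proof -
    have "(\<phi> has_derivative (\<lambda>h. \<chi> i. dir_deriv (\<lambda>z. \<phi> z $ i) z h)) (at z)"
      unfolding has_derivative_componentwise_within[of \<phi>]
    proof (rule ballI)
      fix b :: "complex^'n" assume "b \<in> Basis"
      then obtain i c where b: "b = axis i c" by (auto simp: Basis_vec_def)
      have "((\<lambda>z. \<phi> z $ i) has_derivative dir_deriv (\<lambda>z. \<phi> z $ i) z) (at z)"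
        using \<phi> z by (intro has_derivative_dir_deriv) (auto simp: holomorphic_self_map_def)
      then show "((\<lambda>x. \<phi> x \<bullet> b) has_derivative
          (\<lambda>x. (\<chi> i. dir_deriv (\<lambda>z. \<phi> z $ i) z x) \<bullet> b)) (at z)"
        unfolding b inner_axis using has_derivative_inner_left by fastforce
    qed
    moreover have "\<phi> z \<in> polydisk" using \<phi> z by (auto simp: holomorphic_self_map_def)
    ultimately show ?thesis
      by (rule has_derivative_compose[OF _ has_derivative_dir_deriv[OF f]])
  qed
  have sc: "?L z (c *s u) = c * ?L z u" for z u c
  proof -
    have "(\<chi> i. dir_deriv (\<lambda>z. \<phi> z $ i) z (c *s u)) = c *s (\<chi> i. dir_deriv (\<lambda>z. \<phi> z $ i) z u)"
      by (simp add: vec_eq_iff dir_deriv_scale)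
    then show ?thesis by (simp add: dir_deriv_scale)
  qed
  show "holomorphic_polydisk (\<lambda>z. f (\<phi> z))"
    unfolding holomorphic_polydisk_def using * sc by blast
  show "z \<in> polydisk \<Longrightarrow> dir_deriv (\<lambda>z. f (\<phi> z)) z u = ?L z u"
    by (rule dir_deriv_eq[OF *], assumption, rule sc)
qed

lemma
  fixes k :: "'n::finite"
  assumes p: "\<And>w. cmod w < 1 \<Longrightarrow> (p has_field_derivative p' w) (at w)"
  shows holomorphic_polydisk_coord: "holomorphic_polydisk (\<lambda>z :: complex^'n. p (z $ k))"
    and dir_deriv_coord: "z \<in> polydisk \<Longrightarrow> dir_deriv (\<lambda>z. p (z $ k)) z u = p' (z $ k) * u $ k"
proof -
  have *: "((\<lambda>z. p (z $ k)) has_derivative (\<lambda>u. p' (z $ k) * u $ k)) (at z)"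
    if "z \<in> polydisk" for z :: "complex^'n"
  proof -
    have "((\<lambda>z :: complex^'n. z $ k) has_derivative (\<lambda>u. u $ k)) (at z)"
      by (rule bounded_linear_imp_has_derivative) (rule bounded_linear_vec_nth)
    moreover have "(p has_derivative (*) (p' (z $ k))) (at (z $ k))"
      using p[of "z $ k"] that by (simp add: polydisk_def has_field_derivative_def)
    ultimately show ?thesis by (rule has_derivative_compose)
  qed
  then show "holomorphic_polydisk (\<lambda>z :: complex^'n. p (z $ k))"
    unfolding holomorphic_polydisk_def by (force simp: algebra_simps)
  show "z \<in> polydisk \<Longrightarrow> dir_deriv (\<lambda>z. p (z $ k)) z u = p' (z $ k) * u $ k"
    by (rule dir_deriv_eq[OF *]) (simp_all add: algebra_simps)
qed

lemma holomorphic_self_map_component: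
  "holomorphic_self_map \<phi> \<Longrightarrow> holomorphic_polydisk (\<lambda>z. \<phi> z $ k)"
  by (simp add: holomorphic_self_map_def)

lemma self_map_in_polydisk: "holomorphic_self_map \<phi> \<Longrightarrow> z \<in> polydisk \<Longrightarrow> \<phi> z \<in> polydisk"
  by (auto simp: holomorphic_self_map_def)

subsection \<open>The seminorm \<open>Q\<close>\<close>

text \<open>With \<open>dir_deriv_le_Q\<close> this makes \<open>Q f z\<close> the operator norm of
  the derivative at \<open>z\<close> for the Bergman metric, so that estimates can be made one
  direction at a time.\<close>

lemma Q_leI:
  fixes z :: "complex^'n"
  assumes "z \<in> polydisk" "\<And>u. cmod (dir_deriv f z u) \<le> c * sqrt (Re (bergman z u u))"
  shows "Q f z \<le> c"
  unfolding Q_def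
proof (rule cSUP_least[OF nonzero_vec])
  fix u :: "complex^'n" assume "u \<in> UNIV - {0}"
  then show "cmod (\<Sum>k\<in>UNIV. partial_deriv f k z * u $ k) / sqrt (Re (bergman z u u)) \<le> c"
    using assms(2)[of u] bergman_pos[OF assms(1), of u]
    by (simp add: pos_divide_le_eq dir_deriv_def)
qed

lemma dir_deriv_le_Q:
  assumes "z \<in> polydisk"
  shows "cmod (dir_deriv f z u) \<le> Q f z * sqrt (Re (bergman z u u))"
proof (cases "u = 0")
  case False
  then show ?thesis
    using Q_upper[OF assms False, of f] bergman_pos[OF assms False]
    by (simp add: pos_divide_le_eq dir_deriv_def)
qed (simp add: dir_deriv_def bergman_def)

lemma Q_le_lincomb:
  assumes z: "z \<in> polydisk" and "0 \<le> a" "0 \<le> b"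
    and le: "\<And>u. cmod (dir_deriv f z u) \<le> a * cmod (dir_deriv g z u) + b * cmod (dir_deriv h z u)"
  shows "Q f z \<le> a * Q g z + b * Q h z"
proof (rule Q_leI[OF z])
  fix u
  have "cmod (dir_deriv f z u) \<le> a * (Q g z * sqrt (Re (bergman z u u)))
      + b * (Q h z * sqrt (Re (bergman z u u)))"
    by (rule order_trans[OF le]) (intro add_mono mult_left_mono dir_deriv_le_Q assms)
  then show "cmod (dir_deriv f z u) \<le> (a * Q g z + b * Q h z) * sqrt (Re (bergman z u u))"
    by (simp add: algebra_simps)
qed

lemma Q_cong:
  assumes "\<And>u. dir_deriv f z u = dir_deriv g z u"
  shows "Q f z = Q g z"
  using assms unfolding Q_def dir_deriv_def by simp

lemma Q_mult_le:
  assumes "holomorphic_polydisk f" "holomorphic_polydisk g" and z: "z \<in> polydisk"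
  shows "Q (\<lambda>z. f z * g z) z \<le> cmod (f z) * Q g z + cmod (g z) * Q f z"
proof (rule Q_le_lincomb[OF z])
  fix u
  show "cmod (dir_deriv (\<lambda>z. f z * g z) z u)
      \<le> cmod (f z) * cmod (dir_deriv g z u) + cmod (g z) * cmod (dir_deriv f z u)"
    unfolding dir_deriv_mult[OF assms] by (rule order_trans[OF norm_triangle_ineq]) (simp add: norm_mult)
qed simp_all

text \<open>The product rule solved for the term with the derivative of \<open>g\<close>. It turns
  control of a weighted composition into control of the composition multiplied by the modulus of the
  weight.\<close>

lemma Q_factor_le:
  assumes "holomorphic_polydisk f" "holomorphic_polydisk g" and z: "z \<in> polydisk"
  shows "cmod (f z) * Q g z \<le> Q (\<lambda>z. f z * g z) z + cmod (g z) * Q f z"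
proof (cases "f z = 0")
  case True
  then show ?thesis using Q_nonneg[OF z] by simp
next
  case False
  have "Q g z \<le> 1 / cmod (f z) * Q (\<lambda>z. f z * g z) z + cmod (g z) / cmod (f z) * Q f z"
  proof (rule Q_le_lincomb[OF z])
    fix u
    have "f z * dir_deriv g z u = dir_deriv (\<lambda>z. f z * g z) z u - dir_deriv f z u * g z"
      unfolding dir_deriv_mult[OF assms] by simp
    then have "cmod (f z) * cmod (dir_deriv g z u)
        \<le> cmod (dir_deriv (\<lambda>z. f z * g z) z u) + cmod (g z) * cmod (dir_deriv f z u)"
      by (metis norm_mult norm_triangle_ineq4 mult.commute)
    then show "cmod (dir_deriv g z u) \<le> 1 / cmod (f z) * cmod (dir_deriv (\<lambda>z. f z * g z) z u)
        + cmod (g z) / cmod (f z) * cmod (dir_deriv f z u)"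
      using False by (simp add: field_simps)
  qed simp_all
  then show ?thesis using False by (simp add: field_simps)
qed

text \<open>The chain rule separates the partial derivatives of \<open>f\<close>, which Cauchy
  estimates control, from the components of \<phi>.\<close>

lemma Q_comp_le:
  assumes "holomorphic_polydisk f" "holomorphic_self_map \<phi>" and z: "z \<in> polydisk"
  shows "Q (\<lambda>z. f (\<phi> z)) z \<le> (\<Sum>j\<in>UNIV. cmod (partial_deriv f j (\<phi> z)) * Q (\<lambda>z. \<phi> z $ j) z)"
proof (rule Q_leI[OF z])
  fix u
  have "cmod (dir_deriv (\<lambda>z. f (\<phi> z)) z u)
      \<le> (\<Sum>j\<in>UNIV. cmod (partial_deriv f j (\<phi> z)) * cmod (dir_deriv (\<lambda>z. \<phi> z $ j) z u))"
    unfolding dir_deriv_comp[OF assms] dir_deriv_def[of f]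
    by (rule order_trans[OF norm_sum]) (simp add: norm_mult)
  also have "\<dots> \<le> (\<Sum>j\<in>UNIV. cmod (partial_deriv f j (\<phi> z)) *
      (Q (\<lambda>z. \<phi> z $ j) z * sqrt (Re (bergman z u u))))"
    by (intro sum_mono mult_left_mono dir_deriv_le_Q z) simp
  finally show "cmod (dir_deriv (\<lambda>z. f (\<phi> z)) z u)
      \<le> (\<Sum>j\<in>UNIV. cmod (partial_deriv f j (\<phi> z)) * Q (\<lambda>z. \<phi> z $ j) z) * sqrt (Re (bergman z u u))"
    by (simp only: sum_distrib_right mult.assoc)
qed


subsection \<open>Bounded functions and the Bloch norm\<close>

text \<open>Members of \<open>hinf\<close> vanish off the polydisk; test functions given by a
  formula enter the space through this extension.\<close>

definition zero_ext :: "(complex^'n \<Rightarrow> complex) \<Rightarrow> complex^'n \<Rightarrow> complex" where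
  "zero_ext f z = (if z \<in> polydisk then f z else 0)"

lemma zero_ext_eq [simp]: "z \<in> polydisk \<Longrightarrow> zero_ext f z = f z"
  by (simp add: zero_ext_def)

lemma zero_ext_hinf:
  fixes f :: "complex^'n \<Rightarrow> complex"
  assumes "holomorphic_polydisk f" "\<And>z. z \<in> polydisk \<Longrightarrow> cmod (f z) \<le> B"
  shows "zero_ext f \<in> hinf" "hinf_norm (zero_ext f) \<le> B"
proof -
  show "zero_ext f \<in> hinf"
    unfolding hinf_def hol_def
    using holomorphic_polydisk_cong[of "zero_ext f" f] assms(1) assms(2)
    by (auto simp: bounded_iff zero_ext_def)
  show "hinf_norm (zero_ext f) \<le> B"
    unfolding hinf_norm_def using assms(2) zero_in_polydisk by (intro cSUP_least) auto
qed

lemma norm_le_hinf_norm: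
  assumes "f \<in> hinf" "z \<in> polydisk"
  shows "cmod (f z) \<le> hinf_norm f"
  unfolding hinf_norm_def using assms
  by (intro cSUP_upper) (auto simp: hinf_def bounded_iff bdd_above_def)

lemma hinf_holomorphic: "f \<in> hinf \<Longrightarrow> holomorphic_polydisk f"
  by (simp add: hinf_def hol_def)

lemma bloch_holomorphic: "f \<in> bloch \<Longrightarrow> holomorphic_polydisk f"
  by (simp add: bloch_def hol_def)

lemma Q_le_bloch_beta: "f \<in> bloch \<Longrightarrow> z \<in> polydisk \<Longrightarrow> Q f z \<le> bloch_beta f"
  unfolding bloch_beta_def by (intro cSUP_upper) (auto simp: bloch_def)

lemma bloch_beta_le_norm: "bloch_beta f \<le> bloch_norm f"
  by (simp add: bloch_norm_def)

text \<open>Only the value and the first derivative of \<open>f\<close> at \<open>\<phi> z\<close>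
  enter, so altering \<open>f\<close> without changing these leaves \<open>Q\<close> of the image at
  \<open>z\<close> unchanged.\<close>

lemma dir_deriv_weighted_comp:
  assumes "holomorphic_polydisk \<psi>" "holomorphic_self_map \<phi>" "holomorphic_polydisk f" "z \<in> polydisk"
  shows "dir_deriv (weighted_comp \<psi> \<phi> f) z u =
    \<psi> z * dir_deriv f (\<phi> z) (\<chi> i. dir_deriv (\<lambda>z. \<phi> z $ i) z u) + dir_deriv \<psi> z u * f (\<phi> z)"
  unfolding weighted_comp_def
  using assms by (simp add: dir_deriv_mult holomorphic_polydisk_comp dir_deriv_comp)

section \<open>Pointwise growth of Bloch functions\<close>

lemma dir_deriv_scaleR: "dir_deriv f z (c *\<^sub>R u) = c *\<^sub>R dir_deriv f z u"
  by (simp add: dir_deriv_def scaleR_sum_right)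

lemma scaleR_polydisk:
  assumes "z \<in> polydisk" "0 \<le> t" "t \<le> 1"
  shows "t *\<^sub>R z \<in> polydisk"
proof -
  have "t * cmod (z $ k) < 1" for k
  proof -
    have "t * cmod (z $ k) \<le> 1 * cmod (z $ k)" using assms by (intro mult_right_mono) auto
    also have "\<dots> < 1" using assms by (simp add: polydisk_def)
    finally show ?thesis .
  qed
  with assms show ?thesis by (simp add: polydisk_def)
qed

text \<open>Moving towards 0 enlarges every \<open>1 - (cmod (z $ j))\<^sup>2\<close>, so the metric
  at \<open>z\<close> dominates the metric along the whole segment from 0 to
  \<open>z\<close>.\<close>

lemma bergman_scaleR_le:
  assumes z: "z \<in> polydisk" and t: "0 \<le> t" "t \<le> 1"
  shows "Re (bergman (t *\<^sub>R z) u u) \<le> Re (bergman z u u)"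
  unfolding Re_bergman
proof (rule sum_mono)
  fix j
  have lt: "(cmod (z $ j))\<^sup>2 < 1" using z by (simp add: polydisk_def abs_square_less_1)
  have le: "(cmod ((t *\<^sub>R z) $ j))\<^sup>2 \<le> (cmod (z $ j))\<^sup>2"
    using t by (intro power_mono) (auto simp: mult_left_le_one_le)
  then have "(cmod ((t *\<^sub>R z) $ j))\<^sup>2 < 1" using lt by linarith
  with le show "(cmod (u $ j))\<^sup>2 / (1 - (cmod ((t *\<^sub>R z) $ j))\<^sup>2)\<^sup>2
      \<le> (cmod (u $ j))\<^sup>2 / (1 - (cmod (z $ j))\<^sup>2)\<^sup>2"
    using lt by (intro divide_left_mono power_mono mult_pos_pos zero_less_power) (rule zero_le_power2 | linarith)+
qed

text \<open>The mean value inequality on the segment from 0 to \<open>z\<close>. Its purpose is that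
  convergence in Bloch norm forces pointwise convergence.\<close>

lemma norm_le_bloch_norm:
  fixes z :: "complex^'n"
  assumes f: "f \<in> bloch" and z: "z \<in> polydisk"
  shows "cmod (f z) \<le> (1 + sqrt (Re (bergman z z z))) * bloch_norm f"
proof -
  let ?s = "sqrt (Re (bergman z z z))"
  have s: "0 \<le> ?s" unfolding Re_bergman by (intro real_sqrt_ge_zero sum_nonneg) simp
  have b: "0 \<le> bloch_beta f" by (rule bloch_beta_nonneg[OF f])
  have "cmod (f (1 *\<^sub>R z) - f (0 *\<^sub>R z)) \<le> (bloch_beta f * ?s) * norm (1 - 0 :: real)"
  proof (rule differentiable_bound[of "{0..1::real}" "\<lambda>t. f (t *\<^sub>R z)"
        "\<lambda>t h. dir_deriv f (t *\<^sub>R z) (h *\<^sub>R z)"])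
    fix t :: real assume t: "t \<in> {0..1}"
    then have tz: "t *\<^sub>R z \<in> polydisk" using z by (intro scaleR_polydisk) auto
    have "((\<lambda>t. t *\<^sub>R z) has_derivative (\<lambda>h. h *\<^sub>R z)) (at t within {0..1})"
      by (auto intro!: derivative_eq_intros)
    then show "((\<lambda>t. f (t *\<^sub>R z)) has_derivative (\<lambda>h. dir_deriv f (t *\<^sub>R z) (h *\<^sub>R z)))
        (at t within {0..1})"
      by (rule has_derivative_compose[of "\<lambda>t. t *\<^sub>R z" _ t _ f,
            OF _ has_derivative_dir_deriv[OF bloch_holomorphic[OF f] tz]])
    have "cmod (dir_deriv f (t *\<^sub>R z) z) \<le> bloch_beta f * ?s"
    proof (rule order_trans[OF dir_deriv_le_Q[OF tz]], rule mult_mono)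
      show "Q f (t *\<^sub>R z) \<le> bloch_beta f" by (rule Q_le_bloch_beta[OF f tz])
      show "sqrt (Re (bergman (t *\<^sub>R z) z z)) \<le> ?s"
        using t bergman_scaleR_le[OF z] by simp
      show "0 \<le> sqrt (Re (bergman (t *\<^sub>R z) z z))"
        unfolding Re_bergman by (intro real_sqrt_ge_zero sum_nonneg) simp
    qed (rule b)
    then show "onorm (\<lambda>h. dir_deriv f (t *\<^sub>R z) (h *\<^sub>R z)) \<le> bloch_beta f * ?s"
      using b s by (intro onorm_bound) (auto simp: dir_deriv_scaleR mult.commute mult_left_mono)
  qed auto
  then have "cmod (f z - f 0) \<le> bloch_beta f * ?s" by simp
  then have "cmod (f z) \<le> cmod (f 0) + bloch_beta f * ?s"
    using norm_triangle_sub[of "f z" "f 0"] by linarith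
  also have "\<dots> \<le> bloch_norm f + bloch_norm f * ?s"
    using b s by (intro add_mono mult_right_mono) (auto simp: bloch_norm_def)
  finally show ?thesis by (simp add: algebra_simps)
qed

subsection \<open>Closed polydisks\<close>

text \<open>For \<open>r < 1\<close> these form a compact convex exhaustion of the polydisk and
  stand in for arbitrary compact subsets.\<close>

definition poly_cball :: "real \<Rightarrow> (complex^'n) set" where
  "poly_cball r = {z. \<forall>k. cmod (z $ k) \<le> r}"

lemma compact_poly_cball: "compact (poly_cball r :: (complex^'n) set)"
proof -
  have "norm z \<le> (\<Sum>k\<in>(UNIV :: 'n set). r)" if "z \<in> poly_cball r" for z :: "complex^'n"
    unfolding norm_vec_def using that
    by (intro order_trans[OF L2_set_le_sum] sum_mono) (simp_all add: poly_cball_def)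
  then have "bounded (poly_cball r :: (complex^'n) set)" unfolding bounded_iff by blast
  moreover have "closed (poly_cball r :: (complex^'n) set)"
  proof -
    have "poly_cball r = (\<Inter>k. {z :: complex^'n. cmod (z $ k) \<le> r})" by (auto simp: poly_cball_def)
    moreover have "closed {z :: complex^'n. cmod (z $ k) \<le> r}" for k
      by (intro closed_Collect_le continuous_intros)
    ultimately show ?thesis by auto
  qed
  ultimately show ?thesis by (simp add: compact_eq_bounded_closed)
qed

lemma poly_cball_subset: "r < 1 \<Longrightarrow> poly_cball r \<subseteq> polydisk"
  by (auto simp: poly_cball_def polydisk_def intro: le_less_trans)

lemma convex_poly_cball: "convex (poly_cball r :: (complex^'n) set)"
proof (rule convexI)
  fix x y :: "complex^'n" and u v :: real
  assume *: "x \<in> poly_cball r" "y \<in> poly_cball r" "0 \<le> u" "0 \<le> v" "u + v = 1"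
  have "cmod ((u *\<^sub>R x + v *\<^sub>R y) $ k) \<le> r" for k
    using convexD[OF convex_cball[of "0 :: complex" r], of "x $ k" "y $ k" u v] *
    by (simp add: poly_cball_def)
  then show "u *\<^sub>R x + v *\<^sub>R y \<in> poly_cball r" by (simp add: poly_cball_def)
qed

lemma poly_cball_mono: "r \<le> s \<Longrightarrow> poly_cball r \<subseteq> poly_cball s"
  unfolding poly_cball_def by (rule Collect_mono) (metis order_trans)

text \<open>On a nonempty \<open>K\<close> each coordinate modulus attains a maximum below 1; the
  largest of these finitely many maxima serves as the radius.\<close>

lemma compact_subset_poly_cball:
  fixes K :: "(complex^'n) set"
  assumes K: "compact K" "K \<subseteq> polydisk"
  obtains r where "r < 1" "K \<subseteq> poly_cball r"
proof -
  have "\<exists>r<1. \<forall>z\<in>K. cmod (z $ k) \<le> r" for k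
  proof (cases "K = {}")
    case False
    have "continuous_on K (\<lambda>z. cmod (z $ k))" by (intro continuous_intros)
    from continuous_attains_sup[OF K(1) False this]
    obtain x where "x \<in> K" "\<forall>z\<in>K. cmod (z $ k) \<le> cmod (x $ k)" by blast
    with K(2) show ?thesis by (auto simp: polydisk_def)
  qed (auto intro: exI[of _ 0])
  then obtain R where R: "\<And>k. R k < 1" "\<And>k z. z \<in> K \<Longrightarrow> cmod (z $ k) \<le> R k" by metis
  show ?thesis
  proof (rule that)
    show "Max (range R) < 1" using R(1) by simp
    have "R k \<le> Max (range R)" for k by simp
    then show "K \<subseteq> poly_cball (Max (range R))"
      unfolding poly_cball_def using R(2) by (intro subsetI CollectI allI) (rule order_trans)
  qed
qed

lemma polydisk_poly_cballE:
  assumes "z \<in> polydisk"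
  obtains r where "r < 1" "z \<in> poly_cball r"
  by (rule compact_subset_poly_cball[of "{z}"]) (use assms in auto)

subsection \<open>Peak functions\<close>

text \<open>The Szego kernel of the disk at \<open>a\<close>, scaled to take the value 1 at
  \<open>a\<close>. Its difference from 1 is \<open>cnj a\<close> times the Blaschke factor
  \<open>(a - w) / (1 - cnj a * w)\<close>.\<close>

definition bump :: "complex \<Rightarrow> complex \<Rightarrow> complex" where
  "bump a w = (1 - cnj a * a) / (1 - cnj a * w)"

text \<open>With the Blaschke factor \<open>b\<close> of \<open>a\<close>, this is \<open>1 - (cnj a * b w)\<^sup>2\<close>: it takes the value \<open>1\<close>
  to second order at \<open>a\<close>, so multiplying by it changes neither value nor derivative there.\<close>

definition peak :: "complex \<Rightarrow> complex \<Rightarrow> complex" where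
  "peak a w = bump a w * (2 - bump a w)"

text \<open>Two lower bounds for the denominator of \<open>bump\<close>: the one free of
  \<open>a\<close> gives decay at a fixed \<open>w\<close>, the one free of \<open>w\<close> gives a
  uniform bound.\<close>

lemma norm_one_minus_cnj_mult:
  assumes "cmod a < 1" "cmod w < 1"
  shows "1 - cmod w \<le> cmod (1 - cnj a * w)" "1 - cmod a \<le> cmod (1 - cnj a * w)"
    "1 - cnj a * w \<noteq> 0"
proof -
  have *: "1 - cmod a * cmod w \<le> cmod (1 - cnj a * w)"
    using norm_triangle_ineq2[of 1 "cnj a * w"] by (simp add: norm_mult)
  have "cmod a * cmod w \<le> 1 * cmod w" using assms by (intro mult_right_mono) auto
  with * show 1: "1 - cmod w \<le> cmod (1 - cnj a * w)" by linarith
  have "cmod a * cmod w \<le> cmod a * 1" using assms by (intro mult_left_mono) auto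
  with * show "1 - cmod a \<le> cmod (1 - cnj a * w)" by linarith
  show "1 - cnj a * w \<noteq> 0" using 1 assms(2) by auto
qed

lemma norm_one_minus_cnj_self:
  assumes "cmod a < 1"
  shows "cmod (1 - cnj a * a) \<le> 2 * (1 - cmod a)"
proof -
  have "cnj a * a = of_real ((cmod a)\<^sup>2)" using complex_norm_square[of a] by (simp add: mult.commute)
  then have "cmod (1 - cnj a * a) = cmod (of_real (1 - (cmod a)\<^sup>2))" by simp
  also have "\<dots> = 1 - (cmod a)\<^sup>2" using assms by (simp only: norm_of_real) (simp add: abs_square_le_1 less_imp_le)
  also have "\<dots> = (1 + cmod a) * (1 - cmod a)" by (simp add: power2_eq_square algebra_simps)
  also have "\<dots> \<le> 2 * (1 - cmod a)" using assms by (intro mult_right_mono) auto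
  finally show ?thesis .
qed

text \<open>The numerator of \<open>bump\<close> is at most \<open>2 * (1 - cmod a)\<close>. The two
  bounds on its denominator then give a uniform bound 2 and decay as \<open>cmod a\<close> tends to
  1; the other factor of \<open>peak\<close> is at most 4.\<close>

lemma
  assumes a: "cmod a < 1" and w: "cmod w < 1"
  shows norm_peak_le_8: "cmod (peak a w) \<le> 8"
    and norm_peak_le: "cmod (peak a w) \<le> 8 * (1 - cmod a) / (1 - cmod w)"
proof -
  have "cmod (bump a w) \<le> 2 * (1 - cmod a) / (1 - cmod a)"
    unfolding bump_def norm_divide
    using norm_one_minus_cnj_mult[OF a w] norm_one_minus_cnj_self[OF a] a
    by (intro frac_le) auto
  also have "\<dots> = 2" using a by (simp add: field_simps)
  finally have 1: "cmod (bump a w) \<le> 2" .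
  have "cmod (bump a w) \<le> 2 * (1 - cmod a) / (1 - cmod w)"
    unfolding bump_def norm_divide
    using norm_one_minus_cnj_mult[OF a w] norm_one_minus_cnj_self[OF a] a w
    by (intro frac_le) auto
  note 2 = this
  have "cmod (2 - bump a w) \<le> 4" using norm_triangle_ineq4[of 2 "bump a w"] 1 by simp
  then have 3: "cmod (peak a w) \<le> cmod (bump a w) * 4"
    unfolding peak_def norm_mult by (rule mult_left_mono) simp
  show "cmod (peak a w) \<le> 8" using 1 3 by linarith
  have "2 * (1 - cmod a) / (1 - cmod w) * 4 = 8 * (1 - cmod a) / (1 - cmod w)" by simp
  with 2 3 show "cmod (peak a w) \<le> 8 * (1 - cmod a) / (1 - cmod w)" by linarith
qed

definition peak_deriv :: "complex \<Rightarrow> complex \<Rightarrow> complex" where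
  "peak_deriv a w = (1 - cnj a * a) * cnj a / (1 - cnj a * w)\<^sup>2 * (2 - 2 * bump a w)"

lemma has_field_derivative_peak:
  assumes "cmod a < 1" "cmod w < 1"
  shows "(peak a has_field_derivative peak_deriv a w) (at w)"
proof -
  have nz: "1 - cnj a * w \<noteq> 0" by (rule norm_one_minus_cnj_mult(3)[OF assms])
  let ?d = "(1 - cnj a * a) * cnj a / (1 - cnj a * w)\<^sup>2"
  have b: "(bump a has_field_derivative ?d) (at w)"
    unfolding bump_def[abs_def]
    by (rule derivative_eq_intros refl nz)+ (simp add: power2_eq_square)
  have "(peak a has_field_derivative bump a w * (0 - ?d) + ?d * (2 - bump a w)) (at w)"
    unfolding peak_def[abs_def]
    by (rule DERIV_cong[OF DERIV_mult[OF b DERIV_diff[OF DERIV_const b]]]) simp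
  moreover have "bump a w * (0 - d) + d * (2 - bump a w) = d * (2 - 2 * bump a w)" for d
    by (simp add: algebra_simps)
  ultimately show ?thesis unfolding peak_deriv_def by metis
qed

lemma
  assumes "cmod a < 1"
  shows peak_self: "peak a a = 1" and peak_deriv_self: "peak_deriv a a = 0"
proof -
  have "bump a a = 1" using norm_one_minus_cnj_mult(3)[OF assms assms] by (simp add: bump_def)
  then show "peak a a = 1" "peak_deriv a a = 0" by (simp_all add: peak_def peak_deriv_def)
qed

subsection \<open>Consequences of compactness\<close>

text \<open>Compactness yields a subsequence of images converging in Bloch norm. Its limit is also
  the pointwise limit, which is 0. A single small index suffices for the contradiction drawn from
  this later.\<close>

lemma compact_operator_bloch_norm_small:
  fixes \<phi> :: "complex^'n \<Rightarrow> complex^'n"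
  assumes comp: "compact_operator hinf hinf_norm bloch bloch_norm (weighted_comp \<psi> \<phi>)"
    and \<phi>: "holomorphic_self_map \<phi>"
    and h: "\<And>m. h m \<in> hinf" "\<And>m. hinf_norm (h m) \<le> M"
    and lim: "\<And>z. z \<in> polydisk \<Longrightarrow> (\<lambda>m. h m z) \<longlonglongrightarrow> 0"
    and e: "\<epsilon> > 0"
  shows "\<exists>m. bloch_norm (weighted_comp \<psi> \<phi> (h m)) < \<epsilon>"
proof -
  interpret Metric_space bloch "norm_dist bloch bloch_norm :: (complex^'n \<Rightarrow> complex) \<Rightarrow> _"
    by (rule Metric_space_bloch)
  let ?W = "weighted_comp \<psi> \<phi>"
  define \<sigma> where "\<sigma> m = ?W (h m)" for m
  have \<sigma>: "\<sigma> m \<in> bloch" for m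
    using comp h(1) by (auto simp: compact_operator_def \<sigma>_def)
  have "\<forall>S M. S \<subseteq> hinf \<and> (\<forall>f\<in>S. hinf_norm f \<le> M) \<longrightarrow> compactin mtopology (mtopology closure_of (?W ` S))"
    using comp unfolding compact_operator_def norm_topology_def by (elim conjE)
  then have "compactin mtopology (mtopology closure_of (?W ` range h))"
    by (rule allE[of _ "range h"], elim allE[of _ M]) (use h in auto)
  then have seq: "\<exists>l r. l \<in> mtopology closure_of (?W ` range h) \<and> strict_mono r \<and>
      limitin mtopology (\<sigma> \<circ> r) l sequentially" if "range \<sigma> \<subseteq> mtopology closure_of (?W ` range h)"
    using that unfolding compactin_sequentially by (elim conjE allE[of _ \<sigma>] impE)
  have "?W ` range h \<subseteq> mtopology closure_of (?W ` range h)"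
    using \<sigma> by (intro closure_of_subset) (auto simp: \<sigma>_def)
  then have "range \<sigma> \<subseteq> mtopology closure_of (?W ` range h)" by (auto simp: \<sigma>_def)
  from seq[OF this] obtain l r where r: "strict_mono r" and lr: "limitin mtopology (\<sigma> \<circ> r) l sequentially"
    by metis
  have l: "l \<in> bloch" and ev: "\<And>e. e > 0 \<Longrightarrow> eventually (\<lambda>n. bloch_norm (\<lambda>z. \<sigma> (r n) z - l z) < e) sequentially"
    using lr \<sigma> by (auto simp: limitin_metric norm_dist_def)
  have tend: "(\<lambda>n. bloch_norm (\<lambda>z. \<sigma> (r n) z - l z)) \<longlonglongrightarrow> 0"
  proof (rule tendstoI)
    fix e :: real assume "e > 0"
    from ev[OF this] show "\<forall>\<^sub>F n in sequentially. dist (bloch_norm (\<lambda>z. \<sigma> (r n) z - l z)) 0 < e"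
      using bloch_beta_nonneg[OF bloch_diff(1)[OF \<sigma> l]]
      by (simp add: bloch_norm_def)
  qed
  \<comment> \<open>Inside the polydisk the images converge pointwise both to \<open>l\<close> and
    to 0; outside it \<open>l\<close> vanishes as a member of \<open>bloch\<close>.\<close>
  have "l z = 0" for z
  proof (cases "z \<in> polydisk")
    case True
    have "(\<lambda>n. (1 + sqrt (Re (bergman z z z))) * bloch_norm (\<lambda>z. \<sigma> (r n) z - l z)) \<longlonglongrightarrow> 0"
      using tendsto_mult_right_zero[OF tend] .
    then have "(\<lambda>n. \<sigma> (r n) z - l z) \<longlonglongrightarrow> 0"
      by (rule Lim_null_comparison[rotated])
         (intro always_eventually allI norm_le_bloch_norm[OF bloch_diff(1)[OF \<sigma> l] True])
    then have "(\<lambda>n. \<sigma> (r n) z) \<longlonglongrightarrow> l z" by (rule LIM_zero_cancel)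
    moreover have "(\<lambda>n. h (r n) (\<phi> z)) \<longlonglongrightarrow> 0"
      using LIMSEQ_subseq_LIMSEQ[OF lim[OF self_map_in_polydisk[OF \<phi> True]] r] by (simp add: o_def)
    then have "(\<lambda>n. \<sigma> (r n) z) \<longlonglongrightarrow> 0"
      unfolding \<sigma>_def weighted_comp_def by (rule tendsto_mult_right_zero)
    ultimately show ?thesis by (rule LIMSEQ_unique)
  next
    case False
    then show ?thesis using l by (simp add: bloch_def hol_def)
  qed
  then have "eventually (\<lambda>n. bloch_norm (\<sigma> (r n)) < \<epsilon>) sequentially" using ev[OF e] by simp
  then obtain n where "bloch_norm (\<sigma> (r n)) < \<epsilon>" using eventually_happens'[OF sequentially_bot] by blast
  then show ?thesis unfolding \<sigma>_def by blast
qed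

text \<open>The common source of both limits. Uniformity over the unit ball is what later allows the
  supremum in \<open>theta\<close> to be taken.\<close>

lemma compact_operator_uniform_limit:
  fixes \<phi> :: "complex^'n \<Rightarrow> complex^'n"
  assumes comp: "compact_operator hinf hinf_norm bloch bloch_norm (weighted_comp \<psi> \<phi>)"
    and \<phi>: "holomorphic_self_map \<phi>" and \<psi>: "\<psi> \<in> bloch" and e: "\<epsilon> > 0"
  shows "\<exists>K. compact K \<and> K \<subseteq> polydisk \<and> (\<forall>z\<in>polydisk. \<phi> z \<notin> K \<longrightarrow>
    (\<forall>g\<in>hinf. hinf_norm g \<le> 1 \<longrightarrow> Q (weighted_comp \<psi> \<phi> g) z < \<epsilon>))"
proof (rule ccontr)
  assume neg: "\<not> ?thesis"
  \<comment> \<open>Radii increasing to 1: failure for each compact \<open>poly_cball (r m)\<close>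
    produces the bad point \<open>z m\<close> and the bad function \<open>g m\<close>.\<close>
  define r where "r m = 1 - inverse (real (Suc m))" for m
  have "\<exists>z g. z \<in> polydisk \<and> \<phi> z \<notin> poly_cball (r m) \<and> g \<in> hinf \<and> hinf_norm g \<le> 1 \<and>
      \<epsilon> \<le> Q (weighted_comp \<psi> \<phi> g) z" for m
  proof -
    have "compact (poly_cball (r m) :: (complex^'n) set)" "(poly_cball (r m) :: (complex^'n) set) \<subseteq> polydisk"
      by (auto intro!: compact_poly_cball poly_cball_subset simp: r_def simp del: of_nat_Suc)
    with neg show ?thesis by (meson not_less)
  qed
  then obtain z g where z: "\<And>m. z m \<in> polydisk" and notin: "\<And>m. \<phi> (z m) \<notin> poly_cball (r m)"
    and g: "\<And>m. g m \<in> hinf" "\<And>m. hinf_norm (g m) \<le> 1"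
    and Qge: "\<And>m. \<epsilon> \<le> Q (weighted_comp \<psi> \<phi> (g m)) (z m)" by metis
  from notin have "\<exists>k. r m < cmod (\<phi> (z m) $ k)" for m by (auto simp: poly_cball_def not_le)
  then obtain k where k: "\<And>m. r m < cmod (\<phi> (z m) $ k m)" by metis
  define a where "a m = \<phi> (z m) $ k m" for m
  have \<phi>z: "\<phi> (z m) \<in> polydisk" for m by (rule self_map_in_polydisk[OF \<phi> z])
  have a: "cmod (a m) < 1" for m using \<phi>z[of m] by (simp add: a_def polydisk_def)
  \<comment> \<open>The peak sits at the coordinate of \<open>\<phi> (z m)\<close> whose modulus
    exceeds \<open>r m\<close>, so \<open>p m\<close> and \<open>g m\<close> agree to first order at
    \<open>\<phi> (z m)\<close>.\<close>
  define p where "p m w = peak (a m) (w $ k m) * g m w" for m w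
  define h where "h m = zero_ext (p m)" for m
  have g1: "cmod (g m w) \<le> 1" if "w \<in> polydisk" for m w
    using norm_le_hinf_norm[OF g(1) that] g(2) order_trans by blast
  note peakD = has_field_derivative_peak[OF a]
  have hp: "holomorphic_polydisk (\<lambda>w :: complex^'n. peak (a m) (w $ k m))" for m
    by (rule holomorphic_polydisk_coord[OF peakD])
  have p: "holomorphic_polydisk (p m)" for m
    unfolding p_def[abs_def] by (intro holomorphic_polydisk_mult hp hinf_holomorphic g)
  have hle: "cmod (h m w) \<le> cmod (peak (a m) (w $ k m))" if "w \<in> polydisk" for m w
    using g1[OF that] that by (simp add: h_def p_def norm_mult mult_left_le)
  have p8: "cmod (p m w) \<le> 8" if "w \<in> polydisk" for m w
    using hle[OF that, of m] norm_peak_le_8[OF a, of "w $ k m" m] that by (simp add: h_def polydisk_def)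
  have "\<exists>m. bloch_norm (weighted_comp \<psi> \<phi> (h m)) < \<epsilon>"
  proof (rule compact_operator_bloch_norm_small[OF comp \<phi> _ _ _ e])
    show "h m \<in> hinf" "hinf_norm (h m) \<le> 8" for m
      unfolding h_def by (rule zero_ext_hinf[OF p p8]; assumption)+
    fix w :: "complex^'n" assume w: "w \<in> polydisk"
    \<comment> \<open>The chosen coordinate \<open>k m\<close> varies with \<open>m\<close>; summing
      over all coordinates gives a decay constant independent of it.\<close>
    define C where "C = (\<Sum>k\<in>UNIV. 1 / (1 - cmod (w $ k)))"
    have w1: "cmod (w $ k) < 1" for k using w by (simp add: polydisk_def)
    have "cmod (h m w) \<le> 8 * C * inverse (real (Suc m))" for m
    proof -
      have "1 / (1 - cmod (w $ k m)) \<le> C"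
        unfolding C_def by (rule member_le_sum) (use w1 in \<open>auto simp: less_imp_le\<close>)
      moreover have "1 - cmod (a m) \<le> inverse (real (Suc m))" using k[of m] by (simp add: a_def r_def)
      moreover have "0 \<le> C" unfolding C_def by (intro sum_nonneg) (use w1 in \<open>auto simp: less_imp_le\<close>)
      ultimately have "(1 / (1 - cmod (w $ k m))) * (1 - cmod (a m)) \<le> C * inverse (real (Suc m))"
        using a[of m] by (intro mult_mono) auto
      moreover have "8 * (1 - cmod (a m)) / (1 - cmod (w $ k m))
          = 8 * ((1 / (1 - cmod (w $ k m))) * (1 - cmod (a m)))" by simp
      ultimately show ?thesis
        using hle[OF w, of m] norm_peak_le[OF a w1, of m "k m"] by linarith
    qed
    moreover have "(\<lambda>m. 8 * C * inverse (real (Suc m))) \<longlonglongrightarrow> 0"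
      by (rule tendsto_mult_right_zero[OF LIMSEQ_inverse_real_of_nat])
    ultimately show "(\<lambda>m. h m w) \<longlonglongrightarrow> 0"
      by (intro Lim_null_comparison[of "\<lambda>m. h m w"]) (auto intro!: always_eventually)
  qed
  then obtain m where m: "bloch_norm (weighted_comp \<psi> \<phi> (h m)) < \<epsilon>" ..
  have "h m \<in> hinf" unfolding h_def by (rule zero_ext_hinf(1)[OF p p8])
  then have "weighted_comp \<psi> \<phi> (h m) \<in> bloch" using comp by (auto simp: compact_operator_def)
  then have "Q (weighted_comp \<psi> \<phi> (h m)) (z m) < \<epsilon>"
    using m Q_le_bloch_beta[OF _ z] bloch_beta_le_norm by (meson le_less_trans order_trans)
  moreover have "Q (weighted_comp \<psi> \<phi> (h m)) (z m) = Q (weighted_comp \<psi> \<phi> (g m)) (z m)"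
  proof (rule Q_cong)
    fix u
    have "dir_deriv (h m) (\<phi> (z m)) v = dir_deriv (p m) (\<phi> (z m)) v" for v
      unfolding h_def by (rule dir_deriv_cong[of _ "p m"]) (simp_all add: p \<phi>z)
    moreover have "dir_deriv (p m) (\<phi> (z m)) v = dir_deriv (g m) (\<phi> (z m)) v" for v
    proof -
      have "dir_deriv (\<lambda>w. peak (a m) (w $ k m)) (\<phi> (z m)) v = peak_deriv (a m) (a m) * v $ k m"
        using dir_deriv_coord[where p = "peak (a m)" and p' = "peak_deriv (a m)" and k = "k m"
            and u = v, OF peakD \<phi>z] by (simp add: a_def)
      then show ?thesis
        unfolding p_def[abs_def] dir_deriv_mult[OF hp hinf_holomorphic[OF g(1)] \<phi>z]
        by (simp add: peak_self peak_deriv_self a flip: a_def)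
    qed
    moreover have "h m (\<phi> (z m)) = g m (\<phi> (z m))"
      using \<phi>z[of m] by (simp add: h_def p_def peak_self a flip: a_def)
    ultimately show "dir_deriv (weighted_comp \<psi> \<phi> (h m)) (z m) u =
        dir_deriv (weighted_comp \<psi> \<phi> (g m)) (z m) u"
      by (simp add: dir_deriv_weighted_comp bloch_holomorphic[OF \<psi>] \<phi> z
          hinf_holomorphic g(1) \<open>h m \<in> hinf\<close>)
  qed
  ultimately show False using Qge[of m] by simp
qed

text \<open>The constant function 1 is mapped to \<psi>, which gives the first limit. With that
  limit available, \<open>Q_factor_le\<close> removes the derivative of \<psi> and leaves the
  second.\<close>

lemma compact_operator_imp_limits:
  fixes \<phi> :: "complex^'n \<Rightarrow> complex^'n"
  assumes comp: "compact_operator hinf hinf_norm bloch bloch_norm (weighted_comp \<psi> \<phi>)"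
    and \<phi>: "holomorphic_self_map \<phi>" and \<psi>: "\<psi> \<in> bloch"
  shows "lim_to_boundary_zero \<phi> (Q \<psi>)"
    and "lim_to_boundary_zero \<phi> (\<lambda>z. cmod (\<psi> z) * theta \<phi> z)"
proof -
  let ?one = "zero_ext (\<lambda>_ :: complex^'n. 1)"
  have "holomorphic_polydisk (\<lambda>_ :: complex^'n. 1)"
    unfolding holomorphic_polydisk_def by (auto intro!: exI[of _ "\<lambda>_. 0"])
  then have one: "?one \<in> hinf" "hinf_norm ?one \<le> 1"
    by (rule zero_ext_hinf[where B = 1]; simp)+
  have \<psi>1: "weighted_comp \<psi> \<phi> ?one = \<psi>"
  proof
    fix z show "weighted_comp \<psi> \<phi> ?one z = \<psi> z"
      using \<psi> self_map_in_polydisk[OF \<phi>, of z]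
      by (cases "z \<in> polydisk") (auto simp: weighted_comp_def bloch_def hol_def)
  qed
  have *: "\<exists>K. compact K \<and> K \<subseteq> polydisk \<and> (\<forall>z\<in>polydisk. \<phi> z \<notin> K \<longrightarrow>
      Q \<psi> z < \<epsilon> \<and> (\<forall>g\<in>hinf. hinf_norm g \<le> 1 \<longrightarrow> Q (weighted_comp \<psi> \<phi> g) z < \<epsilon>))"
    if "\<epsilon> > 0" for \<epsilon>
    using compact_operator_uniform_limit[OF comp \<phi> \<psi> that] one \<psi>1 by metis
  then show "lim_to_boundary_zero \<phi> (Q \<psi>)"
    unfolding lim_to_boundary_zero_def using Q_nonneg by (metis abs_of_nonneg)
  show "lim_to_boundary_zero \<phi> (\<lambda>z. cmod (\<psi> z) * theta \<phi> z)"
    unfolding lim_to_boundary_zero_def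
  proof (intro allI impI)
    fix \<epsilon> :: real assume e: "\<epsilon> > 0"
    \<comment> \<open>Both terms of \<open>Q_factor_le\<close> fall below a third of \<epsilon>;
      their sum stays strictly below \<epsilon> even after passing to the supremum.\<close>
    then have "\<epsilon> / 3 > 0" by simp
    from *[OF this] obtain K where K: "compact K" "K \<subseteq> polydisk"
      and le: "\<And>z. z \<in> polydisk \<Longrightarrow> \<phi> z \<notin> K \<Longrightarrow> Q \<psi> z < \<epsilon> / 3"
        "\<And>z g. z \<in> polydisk \<Longrightarrow> \<phi> z \<notin> K \<Longrightarrow> g \<in> hinf \<Longrightarrow> hinf_norm g \<le> 1 \<Longrightarrow>
          Q (weighted_comp \<psi> \<phi> g) z < \<epsilon> / 3" by metis
    show "\<exists>K. compact K \<and> K \<subseteq> polydisk \<and>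
        (\<forall>z\<in>polydisk. \<phi> z \<notin> K \<longrightarrow> \<bar>cmod (\<psi> z) * theta \<phi> z\<bar> < \<epsilon>)"
    proof (intro exI conjI ballI impI)
      fix z assume z: "z \<in> polydisk" and zK: "\<phi> z \<notin> K"
      have bound: "cmod (\<psi> z) * Q (g \<circ> \<phi>) z \<le> 2 * \<epsilon> / 3" if g: "g \<in> hinf" "hinf_norm g \<le> 1" for g
      proof -
        have "cmod (\<psi> z) * Q (\<lambda>z. g (\<phi> z)) z
            \<le> Q (\<lambda>z. \<psi> z * g (\<phi> z)) z + cmod (g (\<phi> z)) * Q \<psi> z"
          by (rule Q_factor_le[OF bloch_holomorphic[OF \<psi>]
                holomorphic_polydisk_comp[OF hinf_holomorphic[OF g(1)] \<phi>] z])
        also have "cmod (g (\<phi> z)) * Q \<psi> z \<le> 1 * Q \<psi> z"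
          using norm_le_hinf_norm[OF g(1) self_map_in_polydisk[OF \<phi> z]] g(2)
          by (intro mult_right_mono Q_nonneg z) auto
        finally show ?thesis
          using le(1)[OF z zK] le(2)[OF z zK g] by (simp add: weighted_comp_def o_def)
      qed
      have ne: "{f \<in> hinf. hinf_norm f \<le> 1} \<noteq> ({} :: (complex^'n \<Rightarrow> complex) set)" using one by blast
      have "0 \<le> Q (?one \<circ> \<phi>) z" by (rule Q_nonneg[OF z])
      also have "\<dots> \<le> theta \<phi> z"
        unfolding theta_def using one by (intro cSUP_upper bdd_above_theta \<phi> z) auto
      finally have th: "0 \<le> theta \<phi> z" .
      have "cmod (\<psi> z) * theta \<phi> z \<le> 2 * \<epsilon> / 3"
      proof (cases "\<psi> z = 0")
        case False
        have "theta \<phi> z \<le> 2 * \<epsilon> / 3 / cmod (\<psi> z)"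
          unfolding theta_def
        proof (rule cSUP_least[OF ne])
          fix g :: "complex^'n \<Rightarrow> complex" assume "g \<in> {f \<in> hinf. hinf_norm f \<le> 1}"
          then show "Q (g \<circ> \<phi>) z \<le> 2 * \<epsilon> / 3 / cmod (\<psi> z)"
            using bound[of g] False by (simp add: pos_le_divide_eq mult_ac)
        qed
        then show ?thesis using False by (simp add: pos_le_divide_eq mult.commute)
      qed (use e in simp)
      then show "\<bar>cmod (\<psi> z) * theta \<phi> z\<bar> < \<epsilon>" using e th by simp
    qed (use K in auto)
  qed
qed

subsection \<open>Cauchy estimates and Montel's theorem on the polydisk\<close>

text \<open>Cauchy's inequality in the \<open>k\<close>-th variable on a disk of radius
  \<open>(1 - r) / 2\<close>, which keeps the point within the polydisk of radius
  \<open>r + (1 - r) / 2 = (1 + r) / 2\<close>.\<close>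

lemma norm_partial_deriv_le:
  fixes z :: "complex^'n"
  assumes f: "holomorphic_polydisk f" and r: "r < 1" and z: "z \<in> poly_cball r"
    and B: "\<And>w. w \<in> poly_cball ((1 + r) / 2) \<Longrightarrow> cmod (f w) \<le> B"
  shows "cmod (partial_deriv f k z) \<le> 2 * B / (1 - r)"
proof -
  define g where "g = (\<lambda>w. f (\<chi> j. if j = k then w else z $ j))"
  define \<rho> where "\<rho> = (1 - r) / 2"
  have \<rho>: "\<rho> > 0" using r by (simp add: \<rho>_def)
  have mem: "(\<chi> j. if j = k then w else z $ j) \<in> poly_cball ((1 + r) / 2)"
    if "w \<in> cball (z $ k) \<rho>" for w
  proof -
    have "cmod w \<le> cmod (z $ k) + cmod (w - z $ k)" by (metis norm_triangle_sub)
    also have "\<dots> \<le> r + \<rho>"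
      using that z by (intro add_mono) (auto simp: poly_cball_def dist_norm norm_minus_commute)
    finally have "cmod w \<le> (1 + r) / 2" by (simp add: \<rho>_def field_simps)
    moreover have "cmod (z $ j) \<le> (1 + r) / 2" for j
    proof -
      have "cmod (z $ j) \<le> r" using z by (simp add: poly_cball_def)
      with r show ?thesis by simp
    qed
    ultimately show ?thesis by (simp add: poly_cball_def)
  qed
  have sub: "poly_cball ((1 + r) / 2) \<subseteq> (polydisk :: (complex^'n) set)"
    using r by (intro poly_cball_subset) simp
  have hd: "g field_differentiable at w" if "w \<in> cball (z $ k) \<rho>" for w
  proof -
    have "(\<chi> j. if j = k then w else z $ j) \<in> polydisk" using mem[OF that] sub by blast
    from slice_has_field_derivative[OF has_derivative_dir_deriv[OF f this] dir_deriv_scale]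
    show ?thesis unfolding g_def field_differentiable_def by (rule exI)
  qed
  have "cmod ((deriv ^^ 1) g (z $ k)) \<le> fact 1 * B / \<rho> ^ 1"
  proof (rule Cauchy_inequality[OF _ _ \<rho>])
    have hd': "g field_differentiable at w" if "w \<in> ball (z $ k) \<rho>" for w
      using that by (intro hd) simp
    show "g holomorphic_on ball (z $ k) \<rho>"
      unfolding holomorphic_on_def
      by (rule ballI, rule field_differentiable_at_within, rule hd')
    show "continuous_on (cball (z $ k) \<rho>) g"
      by (intro continuous_at_imp_continuous_on ballI field_differentiable_imp_continuous_at hd)
    show "cmod (g x) \<le> B" if "cmod (z $ k - x) = \<rho>" for x
      unfolding g_def using that by (intro B mem) (simp add: dist_norm)
  qed
  then show ?thesis by (simp add: partial_deriv_def g_def \<rho>_def mult.commute)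
qed

text \<open>Cauchy estimates for all partial derivatives, combined with the mean value inequality on
  a convex set. This supplies the equicontinuity for Montel's theorem.\<close>

lemma lipschitz_on_poly_cball:
  fixes f :: "complex^'n \<Rightarrow> complex"
  assumes f: "holomorphic_polydisk f" and r: "r < 1"
    and B: "\<And>w. w \<in> poly_cball ((1 + r) / 2) \<Longrightarrow> cmod (f w) \<le> B"
    and zw: "z \<in> poly_cball r" "w \<in> poly_cball r"
  shows "cmod (f z - f w) \<le> (real CARD('n) * (2 * B / (1 - r))) * norm (z - w)"
proof (rule differentiable_bound[OF convex_poly_cball[of r] _ _ zw])
  fix x :: "complex^'n" assume x: "x \<in> poly_cball r"
  then have "x \<in> polydisk" using poly_cball_subset[OF r] by blast
  then show "(f has_derivative dir_deriv f x) (at x within poly_cball r)"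
    by (rule has_derivative_at_withinI[OF has_derivative_dir_deriv[OF f]])
  have "(\<Sum>k\<in>UNIV. cmod (partial_deriv f k x)) \<le> (\<Sum>k\<in>(UNIV :: 'n set). 2 * B / (1 - r))"
    by (rule sum_mono, rule norm_partial_deriv_le[OF f r x B])
  then have le: "(\<Sum>k\<in>UNIV. cmod (partial_deriv f k x)) \<le> real CARD('n) * (2 * B / (1 - r))" by simp
  \<comment> \<open>The sign of the Lipschitz constant is read off from the quantity it bounds, as
    \<open>B\<close> is not assumed nonnegative.\<close>
  have "0 \<le> (\<Sum>k\<in>UNIV. cmod (partial_deriv f k x))" by (intro sum_nonneg) simp
  with le have "0 \<le> real CARD('n) * (2 * B / (1 - r))" by linarith
  then show "onorm (dir_deriv f x) \<le> real CARD('n) * (2 * B / (1 - r))"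
    by (rule onorm_bound) (rule order_trans[OF norm_dir_deriv_le mult_right_mono[OF le norm_ge_zero]])
qed

text \<open>Cauchy estimates for differences make the partial derivatives uniformly Cauchy, so
  differentiation passes to the limit; the limiting derivative is again a sum of coordinate
  multiples, hence complex linear.\<close>

lemma holomorphic_polydisk_uniform_limit:
  fixes f :: "nat \<Rightarrow> complex^'n \<Rightarrow> complex"
  assumes f: "\<And>m. holomorphic_polydisk (f m)"
    and lim: "\<And>r. r < 1 \<Longrightarrow> uniform_limit (poly_cball r) f g sequentially"
  shows "holomorphic_polydisk g"
  unfolding holomorphic_polydisk_def
proof (rule ballI)
  fix z :: "complex^'n" assume "z \<in> polydisk"
  then obtain r0 where r0: "r0 < 1" "z \<in> poly_cball r0" by (rule polydisk_poly_cballE)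
  define r where "r = (1 + r0) / 2"
  \<comment> \<open>An open convex neighbourhood of \<open>z\<close> on which termwise
    differentiation applies.\<close>
  define S where "S = {w :: complex^'n. \<forall>k. cmod (w $ k) < r}"
  have r: "r < 1" "r0 < r" using r0 by (auto simp: r_def)
  have zS: "z \<in> S" using r0(2) r(2) by (auto simp: S_def poly_cball_def intro: le_less_trans)
  have Sr: "S \<subseteq> poly_cball r" by (auto simp: S_def poly_cball_def less_imp_le)
  have Sp: "S \<subseteq> polydisk" using Sr poly_cball_subset[OF r(1)] by blast
  have "S = (\<Inter>k. {w. cmod (w $ k) < r})" by (auto simp: S_def)
  moreover have "open (\<Inter>k. {w :: complex^'n. cmod (w $ k) < r})"
    by (intro open_INT ballI open_Collect_less continuous_intros) simp
  ultimately have opS: "open S" by simp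
  have cvS: "convex S"
  proof (rule convexI)
    fix x y :: "complex^'n" and u v :: real
    assume *: "x \<in> S" "y \<in> S" "0 \<le> u" "0 \<le> v" "u + v = 1"
    have "cmod ((u *\<^sub>R x + v *\<^sub>R y) $ k) < r" for k
      using convexD[OF convex_ball[of "0 :: complex" r], of "x $ k" "y $ k" u v] *
      by (simp add: S_def)
    then show "u *\<^sub>R x + v *\<^sub>R y \<in> S" by (simp add: S_def)
  qed
  have "uniformly_convergent_on S (\<lambda>m. partial_deriv (f m) k)" for k
    unfolding uniformly_convergent_eq_Cauchy uniformly_Cauchy_on_def
  proof (intro allI impI)
    fix e :: real assume e: "e > 0"
    \<comment> \<open>Chosen so that the Cauchy bound \<open>2 * d / (1 - r)\<close> equals
      \<open>e / 2\<close>.\<close>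
    define d where "d = e * (1 - r) / 4"
    have d: "d > 0" using e r by (simp add: d_def)
    have "uniformly_convergent_on (poly_cball ((1 + r) / 2)) f"
      using lim[of "(1 + r) / 2"] r by (auto simp: uniformly_convergent_on_def)
    then obtain M where M: "\<And>x m n. x \<in> poly_cball ((1 + r) / 2) \<Longrightarrow> m \<ge> M \<Longrightarrow> n \<ge> M \<Longrightarrow> dist (f m x) (f n x) < d"
      unfolding uniformly_convergent_eq_Cauchy uniformly_Cauchy_on_def using d by metis
    show "\<exists>M. \<forall>x\<in>S. \<forall>m\<ge>M. \<forall>n\<ge>M. dist (partial_deriv (f m) k x) (partial_deriv (f n) k x) < e"
    proof (intro exI ballI allI impI)
      fix x m n assume x: "x \<in> S" and mn: "M \<le> m" "M \<le> n"
      let ?h = "\<lambda>z. 1 * f m z + (-1) * f n z"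
      have "cmod (partial_deriv ?h k x) \<le> 2 * d / (1 - r)"
      proof (rule norm_partial_deriv_le[OF _ r(1)])
        show "holomorphic_polydisk ?h" by (intro holomorphic_polydisk_lincomb(1) f)
        show "cmod (?h w) \<le> d" if "w \<in> poly_cball ((1 + r) / 2)" for w
          using M[OF that mn] by (simp add: dist_norm)
      qed (use x Sr in auto)
      also have "partial_deriv ?h k x = partial_deriv (f m) k x - partial_deriv (f n) k x"
        using holomorphic_polydisk_lincomb(2)[OF f f, of x 1 m "-1" n k] x Sp by auto
      also have "2 * d / (1 - r) = e / 2" using r by (simp add: d_def field_simps)
      also have "\<dots> < e" using e by simp
      finally show "dist (partial_deriv (f m) k x) (partial_deriv (f n) k x) < e" by (simp add: dist_norm)
    qed
  qed
  then obtain p where p: "\<And>k. uniform_limit S (\<lambda>m. partial_deriv (f m) k) (p k) sequentially"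
    unfolding uniformly_convergent_on_def by metis
  define g' where "g' x h = (\<Sum>k\<in>UNIV. p k x * h $ k)" for x h :: "complex^'n"
  have "\<exists>G. \<forall>x\<in>S. (\<lambda>n. f n x) \<longlonglongrightarrow> G x \<and> (G has_derivative g' x) (at x within S)"
  proof (rule has_derivative_sequence[OF cvS _ _ zS])
    show "(f n has_derivative dir_deriv (f n) x) (at x within S)" if "x \<in> S" for n x
      by (rule has_derivative_at_withinI[OF has_derivative_dir_deriv[OF f]]) (use that Sp in blast)
    show "(\<lambda>n. f n z) \<longlonglongrightarrow> g z"
      using tendsto_uniform_limitI[OF lim[OF r0(1)], of z] r0(2) by simp
    fix e :: real assume e: "e > 0"
    have "\<forall>\<^sub>F n in sequentially. \<forall>k. \<forall>x\<in>S. dist (partial_deriv (f n) k x) (p k x) < e / CARD('n)"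
      using p e unfolding uniform_limit_iff by (intro eventually_all_finite) simp
    then show "\<forall>\<^sub>F n in sequentially. \<forall>x\<in>S. \<forall>h. cmod (dir_deriv (f n) x h - g' x h) \<le> e * norm h"
    proof eventually_elim
      case (elim n)
      show ?case
      proof (intro ballI allI)
        fix x h assume x: "x \<in> S"
        have "dir_deriv (f n) x h - g' x h = (\<Sum>k\<in>UNIV. (partial_deriv (f n) k x - p k x) * h $ k)"
          by (simp add: dir_deriv_def g'_def left_diff_distrib sum_subtractf)
        also have "cmod \<dots> \<le> (\<Sum>k\<in>(UNIV :: 'n set). e / CARD('n) * norm h)"
        proof (intro order_trans[OF norm_sum] sum_mono)
          fix k
          have "cmod (partial_deriv (f n) k x - p k x) \<le> e / CARD('n)"
            using elim x by (auto simp: dist_norm less_imp_le)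
          then show "cmod ((partial_deriv (f n) k x - p k x) * h $ k) \<le> e / CARD('n) * norm h"
            unfolding norm_mult
            by (intro mult_mono Finite_Cartesian_Product.norm_nth_le) (use e in auto)
        qed
        finally show "cmod (dir_deriv (f n) x h - g' x h) \<le> e * norm h" by simp
      qed
    qed
  qed
  then obtain G where G: "\<And>x. x \<in> S \<Longrightarrow> (\<lambda>n. f n x) \<longlonglongrightarrow> G x"
    "\<And>x. x \<in> S \<Longrightarrow> (G has_derivative g' x) (at x within S)" by blast
  have "(g has_derivative g' z) (at z)"
  proof (rule has_derivative_transform_within_open[OF _ opS zS])
    show "(G has_derivative g' z) (at z)" using G(2)[OF zS] unfolding at_within_open[OF zS opS] .
    show "G x = g x" if "x \<in> S" for x
      by (rule LIMSEQ_unique[OF G(1)[OF that] tendsto_uniform_limitI[OF lim[OF r(1)]]])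
        (use that Sr in blast)
  qed
  moreover have "\<forall>c v. g' z (c *s v) = c * g' z v" by (simp add: g'_def sum_distrib_left mult_ac)
  ultimately show "\<exists>L. (g has_derivative L) (at z) \<and> (\<forall>c v. L (c *s v) = c * L v)"
    by (intro exI[of _ "g' z"] conjI)
qed

text \<open>Arzela-Ascoli gives a uniformly convergent subsequence on each set of a compact
  exhaustion; a diagonal subsequence works on all of them.\<close>

theorem Montel_polydisk:
  fixes f :: "nat \<Rightarrow> complex^'n \<Rightarrow> complex"
  assumes f: "\<And>m. holomorphic_polydisk (f m)"
    and M: "\<And>m z. z \<in> polydisk \<Longrightarrow> cmod (f m z) \<le> M"
  obtains s g where "strict_mono (s :: nat \<Rightarrow> nat)" "holomorphic_polydisk g"
    "\<And>z. z \<in> polydisk \<Longrightarrow> cmod (g z) \<le> M"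
    "\<And>r. r < 1 \<Longrightarrow> uniform_limit (poly_cball r) (\<lambda>n. f (s n)) g sequentially"
proof -
  define R where "R i = 1 - inverse (real (Suc i))" for i
  have R: "R i < 1" for i by (simp add: R_def del: of_nat_Suc)
  obtain s :: "nat \<Rightarrow> nat" where s: "strict_mono s"
    and conv: "\<And>i. uniformly_convergent_on (poly_cball (R i)) (\<lambda>n. f ((id \<circ> s) n))"
  proof (rule subsequence_diagonalization_lemma
      [of "\<lambda>i k. uniformly_convergent_on (poly_cball (R i)) (\<lambda>n. f (k n))" id])
    fix i and r :: "nat \<Rightarrow> nat"
    define L where "L = real CARD('n) * (2 * M / (1 - R i))"
    have "0 \<le> M" using order_trans[OF norm_ge_zero M[OF zero_in_polydisk, of 0]] .
    then have L: "0 \<le> L" using R[of i] unfolding L_def by simp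
    have lip: "cmod (f (r n) x - f (r n) y) \<le> L * norm (x - y)"
      if "x \<in> poly_cball (R i)" "y \<in> poly_cball (R i)" for n x y
      unfolding L_def
    proof (rule lipschitz_on_poly_cball[OF f R _ that])
      have "poly_cball ((1 + R i) / 2) \<subseteq> (polydisk :: (complex^'n) set)"
        using R[of i] by (intro poly_cball_subset) simp
      then show "cmod (f (r n) w) \<le> M" if "w \<in> poly_cball ((1 + R i) / 2)" for w
        using that by (intro M) auto
    qed
    show "\<exists>k. strict_mono (k :: nat \<Rightarrow> nat) \<and>
        uniformly_convergent_on (poly_cball (R i)) (\<lambda>n. f ((r \<circ> k) n))"
    proof (rule Arzela_Ascoli[of "poly_cball (R i) :: (complex^'n) set" "\<lambda>n. f (r n)" M])
      show "cmod (f (r n) x) \<le> M" if "x \<in> poly_cball (R i)" for n x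
        using that poly_cball_subset[OF R] by (intro M) auto
      show "\<exists>d>0. \<forall>n y. y \<in> poly_cball (R i) \<and> norm (x - y) < d \<longrightarrow> cmod (f (r n) x - f (r n) y) < e"
        if x: "x \<in> poly_cball (R i)" and e: "0 < e" for x e
      proof (intro exI conjI allI impI)
        \<comment> \<open>Using \<open>L + 1\<close> avoids division by zero when the Lipschitz
          constant \<open>L\<close> is 0.\<close>
        show "e / (L + 1) > 0" using e L by simp
        fix n y assume y: "y \<in> poly_cball (R i) \<and> norm (x - y) < e / (L + 1)"
        have "cmod (f (r n) x - f (r n) y) \<le> (L + 1) * norm (x - y)"
          using lip[OF x, of y n] y by (simp add: distrib_right add_increasing2)
        also have "\<dots> < e" using y L by (simp add: pos_less_divide_eq mult.commute)
        finally show "cmod (f (r n) x - f (r n) y) < e" .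
      qed
      fix g and k :: "nat \<Rightarrow> nat"
      assume "strict_mono k"
        and *: "\<And>e. 0 < e \<Longrightarrow> \<exists>N. \<forall>n x. n \<ge> N \<and> x \<in> poly_cball (R i) \<longrightarrow> cmod (f (r (k n)) x - g x) < e"
      have "uniform_limit (poly_cball (R i)) (\<lambda>n. f ((r \<circ> k) n)) g sequentially"
        unfolding uniform_limit_sequentially_iff o_def dist_norm using * by meson
      then show "\<exists>k. strict_mono (k :: nat \<Rightarrow> nat) \<and>
          uniformly_convergent_on (poly_cball (R i)) (\<lambda>n. f ((r \<circ> k) n))"
        using \<open>strict_mono k\<close> uniformly_convergent_on_def by blast
    qed (rule compact_poly_cball)
  next
    \<comment> \<open>The diagonal argument needs uniform convergence to survive when, from
      \<open>N\<close> on, each term of \<open>k2\<close> is a term of \<open>k1\<close> with at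
      least the same index.\<close>
    fix i N and r k1 k2 :: "nat \<Rightarrow> nat"
    assume "uniformly_convergent_on (poly_cball (R i)) (\<lambda>n. f ((r \<circ> k1) n))"
      and k2: "\<And>j. N \<le> j \<Longrightarrow> \<exists>j'\<ge>j. k2 j = k1 j'"
    then obtain l where l: "uniform_limit (poly_cball (R i)) (\<lambda>n. f ((r \<circ> k1) n)) l sequentially"
      unfolding uniformly_convergent_on_def by blast
    have "uniform_limit (poly_cball (R i)) (\<lambda>n. f ((r \<circ> k2) n)) l sequentially"
      unfolding uniform_limit_sequentially_iff
    proof (intro allI impI)
      fix e :: real assume "e > 0"
      with l obtain N' where N': "\<And>n x. n \<ge> N' \<Longrightarrow> x \<in> poly_cball (R i) \<Longrightarrow> dist (f ((r \<circ> k1) n) x) (l x) < e"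
        unfolding uniform_limit_sequentially_iff by blast
      have "dist (f ((r \<circ> k2) n) x) (l x) < e" if n: "n \<ge> max N N'" and "x \<in> poly_cball (R i)" for n x
      proof -
        obtain j where "j \<ge> n" "k2 n = k1 j" using k2[of n] n by auto
        then show ?thesis using N'[of j x] n that(2) by simp
      qed
      then show "\<exists>N. \<forall>n\<ge>N. \<forall>x\<in>poly_cball (R i). dist (f ((r \<circ> k2) n) x) (l x) < e" by blast
    qed
    then show "uniformly_convergent_on (poly_cball (R i)) (\<lambda>n. f ((r \<circ> k2) n))"
      unfolding uniformly_convergent_on_def by blast
  qed (rule that)
  \<comment> \<open>The pointwise limit glues the uniform limits on the individual closed polydisks
    into one function.\<close>
  define g where "g z = lim (\<lambda>n. f (s n) z)" for z
  have ul: "uniform_limit (poly_cball r) (\<lambda>n. f (s n)) g sequentially" if r: "r < 1" for r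
  proof -
    obtain i where "inverse (real (Suc i)) < 1 - r" using r reals_Archimedean[of "1 - r"] by auto
    then have "r \<le> R i" by (simp add: R_def)
    have "uniform_limit (poly_cball (R i)) (\<lambda>n. f (s n)) g sequentially"
      using conv[of i] unfolding g_def[abs_def] uniformly_convergent_uniform_limit_iff by simp
    then show ?thesis by (rule uniform_limit_on_subset) (rule poly_cball_mono[OF \<open>r \<le> R i\<close>])
  qed
  show ?thesis
  proof (rule that[OF s _ _ ul])
    show "holomorphic_polydisk g" by (rule holomorphic_polydisk_uniform_limit[OF f ul])
    fix z :: "complex^'n" assume z: "z \<in> polydisk"
    then obtain r where "r < 1" "z \<in> poly_cball r" by (rule polydisk_poly_cballE)
    then have "(\<lambda>n. f (s n) z) \<longlonglongrightarrow> g z" by (intro tendsto_uniform_limitI[OF ul]) auto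
    from tendsto_norm[OF this] show "cmod (g z) \<le> M"
      by (rule tendsto_upperbound) (auto intro!: always_eventually M z)
  qed
qed

subsection \<open>Compactness from the boundary limits\<close>

lemma dir_deriv_smult:
  assumes "holomorphic_polydisk f" "z \<in> polydisk"
  shows "dir_deriv (\<lambda>z. c * f z) z u = c * dir_deriv f z u"
  using holomorphic_polydisk_lincomb(2)[OF assms(1,1,2), of c 0]
  by (simp add: dir_deriv_def sum_distrib_left mult_ac)

text \<open>Division by \<open>B\<close> and extension by 0 place \<open>g\<close> in the unit ball
  over which \<open>theta\<close> takes its supremum.\<close>

lemma Q_comp_le_theta:
  fixes z :: "complex^'n"
  assumes \<phi>: "holomorphic_self_map \<phi>" and z: "z \<in> polydisk" and g: "holomorphic_polydisk g"
    and B: "B > 0" "\<And>w. w \<in> polydisk \<Longrightarrow> cmod (g w) \<le> B"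
  shows "Q (\<lambda>z. g (\<phi> z)) z \<le> B * theta \<phi> z"
proof -
  define p where "p w = of_real (1 / B) * g w" for w
  have p: "holomorphic_polydisk p"
    unfolding p_def[abs_def] using holomorphic_polydisk_lincomb(1)[OF g g, of "of_real (1 / B)" 0] by simp
  have p1: "cmod (p w) \<le> 1" if "w \<in> polydisk" for w
    using B(1) B(2)[OF that] by (simp add: p_def norm_mult norm_divide)
  let ?f = "zero_ext p"
  have f: "?f \<in> hinf" "hinf_norm ?f \<le> 1" by (rule zero_ext_hinf[OF p p1]; assumption)+
  have d: "dir_deriv ?f (\<phi> z) v = of_real (1 / B) * dir_deriv g (\<phi> z) v" for v
  proof -
    have "dir_deriv ?f (\<phi> z) v = dir_deriv p (\<phi> z) v"
      by (rule dir_deriv_cong[of _ p]) (simp_all add: p self_map_in_polydisk[OF \<phi> z])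
    then show ?thesis
      unfolding p_def[abs_def] dir_deriv_smult[OF g self_map_in_polydisk[OF \<phi> z]] .
  qed
  \<comment> \<open>The summand with coefficient 0 only fits the estimate to the two-term form of
    \<open>Q_le_lincomb\<close>.\<close>
  have "Q (\<lambda>z. g (\<phi> z)) z \<le> B * Q (\<lambda>z. ?f (\<phi> z)) z + 0 * Q (\<lambda>z. ?f (\<phi> z)) z"
  proof (rule Q_le_lincomb[OF z])
    fix u
    show "cmod (dir_deriv (\<lambda>z. g (\<phi> z)) z u) \<le> B * cmod (dir_deriv (\<lambda>z. ?f (\<phi> z)) z u)
        + 0 * cmod (dir_deriv (\<lambda>z. ?f (\<phi> z)) z u)"
      unfolding dir_deriv_comp[OF g \<phi> z] dir_deriv_comp[OF hinf_holomorphic[OF f(1)] \<phi> z] d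
      using B(1) by (simp add: norm_mult norm_divide)
  qed (use B in auto)
  also have "\<dots> = B * Q (?f \<circ> \<phi>) z" by (simp add: o_def)
  also have "Q (?f \<circ> \<phi>) z \<le> theta \<phi> z"
    unfolding theta_def using f by (intro cSUP_upper bdd_above_theta \<phi> z) auto
  finally show ?thesis using B(1) by simp
qed

text \<open>The \<open>j\<close>-th coordinate function is mapped into the Bloch space with image
  \<open>\<psi> z * \<phi> z $ j\<close>; \<open>Q_factor_le\<close> and the bound 1 on the
  components give the estimate. Summing over \<open>j\<close> yields a single constant.\<close>

lemma weighted_Q_component_bounded:
  fixes \<phi> :: "complex^'n \<Rightarrow> complex^'n"
  assumes \<phi>: "holomorphic_self_map \<phi>" and \<psi>: "\<psi> \<in> bloch"
    and W: "weighted_comp \<psi> \<phi> ` hinf \<subseteq> bloch"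
  obtains C where "C \<ge> 0" "\<And>z j. z \<in> polydisk \<Longrightarrow> cmod (\<psi> z) * Q (\<lambda>z. \<phi> z $ j) z \<le> C"
proof -
  have "\<exists>C\<ge>0. \<forall>z\<in>polydisk. cmod (\<psi> z) * Q (\<lambda>z. \<phi> z $ j) z \<le> C" for j
  proof -
    let ?c = "zero_ext (\<lambda>w :: complex^'n. w $ j)"
    have "holomorphic_polydisk (\<lambda>w :: complex^'n. w $ j)"
      by (rule holomorphic_polydisk_coord[where p = "\<lambda>w. w" and p' = "\<lambda>_. 1"]) simp
    then have "?c \<in> hinf"
      by (rule zero_ext_hinf(1)[where B = 1]) (simp add: polydisk_def less_imp_le)
    then have Wc: "weighted_comp \<psi> \<phi> ?c \<in> bloch" using W by blast
    note hc = holomorphic_self_map_component[OF \<phi>, of j]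
    note h\<psi> = bloch_holomorphic[OF \<psi>]
    show ?thesis
    proof (intro exI conjI ballI)
      show "0 \<le> bloch_beta (weighted_comp \<psi> \<phi> ?c) + bloch_beta \<psi>"
        by (intro add_nonneg_nonneg bloch_beta_nonneg Wc \<psi>)
      fix z :: "complex^'n" assume z: "z \<in> polydisk"
      have "cmod (\<psi> z) * Q (\<lambda>z. \<phi> z $ j) z
          \<le> Q (\<lambda>z. \<psi> z * \<phi> z $ j) z + cmod (\<phi> z $ j) * Q \<psi> z"
        by (rule Q_factor_le[OF h\<psi> hc z])
      also have "Q (\<lambda>z. \<psi> z * \<phi> z $ j) z = Q (weighted_comp \<psi> \<phi> ?c) z"
      proof (rule Q_cong, rule dir_deriv_cong[OF _ bloch_holomorphic[OF Wc] z])
        show "\<psi> z * \<phi> z $ j = weighted_comp \<psi> \<phi> ?c z" if "z \<in> polydisk" for z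
          using self_map_in_polydisk[OF \<phi> that] by (simp add: weighted_comp_def)
      qed
      also have "\<dots> \<le> bloch_beta (weighted_comp \<psi> \<phi> ?c)" by (rule Q_le_bloch_beta[OF Wc z])
      also have "cmod (\<phi> z $ j) * Q \<psi> z \<le> 1 * bloch_beta \<psi>"
        using self_map_in_polydisk[OF \<phi> z]
        by (intro mult_mono Q_le_bloch_beta[OF \<psi> z] Q_nonneg z) (auto simp: polydisk_def less_imp_le)
      finally show "cmod (\<psi> z) * Q (\<lambda>z. \<phi> z $ j) z
          \<le> bloch_beta (weighted_comp \<psi> \<phi> ?c) + bloch_beta \<psi>" by simp
    qed
  qed
  then obtain C where C: "\<And>j. C j \<ge> 0" "\<And>j z. z \<in> polydisk \<Longrightarrow> cmod (\<psi> z) * Q (\<lambda>z. \<phi> z $ j) z \<le> C j"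
    by metis
  show ?thesis
  proof (rule that)
    show "0 \<le> sum C UNIV" by (intro sum_nonneg C(1))
    fix z :: "complex^'n" and j assume z: "z \<in> polydisk"
    have "C j \<le> sum C UNIV" by (rule member_le_sum) (auto intro: C(1))
    with C(2)[OF z, of j] show "cmod (\<psi> z) * Q (\<lambda>z. \<phi> z $ j) z \<le> sum C UNIV" by linarith
  qed
qed

text \<open>The product rule leaves two terms. For \<open>\<phi> z\<close> in a fixed closed
  polydisk they are small because \<open>g m\<close> and, by Cauchy, its derivatives are; elsewhere
  the boundary limits and the bound on \<open>g m\<close> apply.\<close>

lemma weighted_comp_bloch_norm_tendsto_0:
  fixes \<phi> :: "complex^'n \<Rightarrow> complex^'n"
  assumes \<phi>: "holomorphic_self_map \<phi>" and \<psi>: "\<psi> \<in> bloch"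
    and W: "weighted_comp \<psi> \<phi> ` hinf \<subseteq> bloch"
    and lim1: "lim_to_boundary_zero \<phi> (Q \<psi>)"
    and lim2: "lim_to_boundary_zero \<phi> (\<lambda>z. cmod (\<psi> z) * theta \<phi> z)"
    and g: "\<And>m. holomorphic_polydisk (g m)" "\<And>m w. w \<in> polydisk \<Longrightarrow> cmod (g m w) \<le> B"
    and unif: "\<And>r. r < 1 \<Longrightarrow> uniform_limit (poly_cball r) g (\<lambda>_. 0) sequentially"
    and e: "\<epsilon> > 0"
  shows "\<forall>\<^sub>F m in sequentially. bloch_norm (weighted_comp \<psi> \<phi> (g m)) < \<epsilon>"
proof -
  define B' where "B' = max B 1"
  have B': "B' > 0" and gB: "\<And>m w. w \<in> polydisk \<Longrightarrow> cmod (g m w) \<le> B'"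
    using g(2) by (auto simp: B'_def intro: le_max_iff_disj[THEN iffD2])
  \<comment> \<open>Near the boundary each of the two terms is at most
    \<open>B' * \<eta> = \<epsilon> / 6\<close>; taking \<open>B'\<close> at least 1 keeps the
    division legitimate.\<close>
  define \<eta> where "\<eta> = \<epsilon> / (6 * B')"
  have \<eta>: "\<eta> > 0" using e B' by (simp add: \<eta>_def)
  obtain K1 where K1: "compact K1" "K1 \<subseteq> polydisk"
    "\<And>z. z \<in> polydisk \<Longrightarrow> \<phi> z \<notin> K1 \<Longrightarrow> \<bar>Q \<psi> z\<bar> < \<eta>"
    using lim1 \<eta> unfolding lim_to_boundary_zero_def by metis
  obtain K2 where K2: "compact K2" "K2 \<subseteq> polydisk"
    "\<And>z. z \<in> polydisk \<Longrightarrow> \<phi> z \<notin> K2 \<Longrightarrow> \<bar>cmod (\<psi> z) * theta \<phi> z\<bar> < \<eta>"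
    using lim2 \<eta> unfolding lim_to_boundary_zero_def by metis
  have \<phi>0: "\<phi> 0 \<in> polydisk" by (rule self_map_in_polydisk[OF \<phi> zero_in_polydisk])
  \<comment> \<open>Including \<open>\<phi> 0\<close> lets the same smallness control the value at 0
    in the Bloch norm.\<close>
  have "compact (insert (\<phi> 0) (K1 \<union> K2))" "insert (\<phi> 0) (K1 \<union> K2) \<subseteq> polydisk"
    using K1(1,2) K2(1,2) \<phi>0 by (simp_all add: compact_insert compact_Un)
  then obtain r where r: "r < 1" and Kr: "insert (\<phi> 0) (K1 \<union> K2) \<subseteq> poly_cball r"
    by (rule compact_subset_poly_cball)
  obtain C where C: "C \<ge> 0" "\<And>z j. z \<in> polydisk \<Longrightarrow> cmod (\<psi> z) * Q (\<lambda>z. \<phi> z $ j) z \<le> C"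
    using weighted_Q_component_bounded[OF \<phi> \<psi> W] by blast
  \<comment> \<open>If \<open>g m\<close> is at most \<delta>, then \<open>\<delta> * A\<close>
    bounds \<open>Q\<close> of the image over the closed polydisk. The constant \<open>D\<close>
    dominates both \<open>A\<close> and \<open>cmod (\<psi> 0)\<close>, so each contribution is at
    most a third of \<epsilon>.\<close>
  define A where "A = bloch_beta \<psi> + real CARD('n) * (2 / (1 - r) * C)"
  define D where "D = cmod (\<psi> 0) + A + 1"
  define \<delta> where "\<delta> = \<epsilon> / (3 * D)"
  have A: "0 \<le> A" unfolding A_def using C(1) r bloch_beta_nonneg[OF \<psi>] by simp
  have D: "D > 0" unfolding D_def using A norm_ge_zero[of "\<psi> 0"] by linarith
  have \<delta>: "\<delta> > 0" using e D by (simp add: \<delta>_def)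
  have \<delta>D: "\<delta> * D = \<epsilon> / 3" using D by (simp add: \<delta>_def)
  have "\<delta> * cmod (\<psi> 0) \<le> \<delta> * D" "\<delta> * A \<le> \<delta> * D"
    using \<delta> A by (auto intro!: mult_left_mono simp: D_def)
  then have \<delta>le: "\<delta> * cmod (\<psi> 0) \<le> \<epsilon> / 3" "\<delta> * A \<le> \<epsilon> / 3" unfolding \<delta>D .
  have sub: "poly_cball r \<subseteq> (poly_cball ((1 + r) / 2) :: (complex^'n) set)"
    using r by (intro poly_cball_mono) simp
  \<comment> \<open>Smallness is taken on the larger radius because the Cauchy estimate at radius
    \<open>r\<close> requires it there.\<close>
  have "\<forall>\<^sub>F m in sequentially. \<forall>w\<in>poly_cball ((1 + r) / 2). dist (g m w) 0 < \<delta>"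
    using unif[of "(1 + r) / 2"] r \<delta> by (simp add: uniform_limit_iff)
  then show ?thesis
  proof eventually_elim
    case (elim m)
    then have small: "cmod (g m w) \<le> \<delta>" if "w \<in> poly_cball ((1 + r) / 2)" for w
      using that by (simp add: less_imp_le)
    note hol = bloch_holomorphic[OF \<psi>] holomorphic_polydisk_comp[OF g(1)[of m] \<phi>]
    have "Q (weighted_comp \<psi> \<phi> (g m)) z \<le> \<epsilon> / 3" if z: "z \<in> polydisk" for z
    proof -
      have "Q (weighted_comp \<psi> \<phi> (g m)) z
          \<le> cmod (\<psi> z) * Q (\<lambda>z. g m (\<phi> z)) z + cmod (g m (\<phi> z)) * Q \<psi> z"
        unfolding weighted_comp_def by (rule Q_mult_le[OF hol z])
      also have "\<dots> \<le> \<epsilon> / 3"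
      proof (cases "\<phi> z \<in> poly_cball r")
        case True
        have "cmod (\<psi> z) * Q (\<lambda>z. g m (\<phi> z)) z
            \<le> cmod (\<psi> z) * (\<Sum>j\<in>UNIV. 2 * \<delta> / (1 - r) * Q (\<lambda>z. \<phi> z $ j) z)"
        proof (rule mult_left_mono[OF order_trans[OF Q_comp_le[OF g(1) \<phi> z]]])
          show "(\<Sum>j\<in>UNIV. cmod (partial_deriv (g m) j (\<phi> z)) * Q (\<lambda>z. \<phi> z $ j) z)
              \<le> (\<Sum>j\<in>UNIV. 2 * \<delta> / (1 - r) * Q (\<lambda>z. \<phi> z $ j) z)"
            by (rule sum_mono, rule mult_right_mono[OF norm_partial_deriv_le[OF g(1) r True small] Q_nonneg[OF z]])
        qed simp
        also have "\<dots> = (\<Sum>j\<in>UNIV. 2 * \<delta> / (1 - r) * (cmod (\<psi> z) * Q (\<lambda>z. \<phi> z $ j) z))"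
          by (simp only: sum_distrib_left mult.left_commute)
        also have "\<dots> \<le> (\<Sum>j\<in>(UNIV :: 'n set). 2 * \<delta> / (1 - r) * C)"
          by (rule sum_mono, rule mult_left_mono[OF C(2)[OF z]]) (use \<delta> r in simp)
        also have "\<dots> = \<delta> * (real CARD('n) * (2 / (1 - r) * C))" by simp
        finally have 1: "cmod (\<psi> z) * Q (\<lambda>z. g m (\<phi> z)) z
            \<le> \<delta> * (real CARD('n) * (2 / (1 - r) * C))" .
        have 2: "cmod (g m (\<phi> z)) * Q \<psi> z \<le> \<delta> * bloch_beta \<psi>"
          using True sub \<delta>
          by (intro mult_mono small Q_le_bloch_beta[OF \<psi> z] Q_nonneg z) auto
        have "\<delta> * A = \<delta> * (real CARD('n) * (2 / (1 - r) * C)) + \<delta> * bloch_beta \<psi>"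
          unfolding A_def by (simp only: distrib_left add.commute)
        with 1 2 \<delta>le(2) show ?thesis by linarith
      next
        case False
        then have "\<phi> z \<notin> K1" "\<phi> z \<notin> K2" using Kr by auto
        note K = K1(3)[OF z this(1)] K2(3)[OF z this(2)]
        have "cmod (\<psi> z) * Q (\<lambda>z. g m (\<phi> z)) z \<le> cmod (\<psi> z) * (B' * theta \<phi> z)"
          by (rule mult_left_mono[OF Q_comp_le_theta[OF \<phi> z g(1) B' gB]]) simp_all
        also have "\<dots> = B' * (cmod (\<psi> z) * theta \<phi> z)" by (simp only: mult.left_commute)
        also have "\<dots> \<le> B' * \<eta>" using K(2) B' by (intro mult_left_mono) auto
        finally have 1: "cmod (\<psi> z) * Q (\<lambda>z. g m (\<phi> z)) z \<le> B' * \<eta>" .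
        have 2: "cmod (g m (\<phi> z)) * Q \<psi> z \<le> B' * \<eta>"
          using K(1) B' by (intro mult_mono gB self_map_in_polydisk[OF \<phi> z] Q_nonneg z) auto
        have "B' * \<eta> = \<epsilon> / 6" using B' by (simp add: \<eta>_def)
        with 1 2 show ?thesis by simp
      qed
      finally show ?thesis .
    qed
    then have b: "bloch_beta (weighted_comp \<psi> \<phi> (g m)) \<le> \<epsilon> / 3"
      unfolding bloch_beta_def using zero_in_polydisk by (intro cSUP_least) auto
    have "cmod (weighted_comp \<psi> \<phi> (g m) 0) \<le> cmod (\<psi> 0) * \<delta>"
      unfolding weighted_comp_def norm_mult
      using Kr sub by (intro mult_left_mono small) auto
    with b \<delta>le(1) e show ?case unfolding bloch_norm_def by (simp add: mult.commute)
  qed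
qed

text \<open>Montel's theorem extracts a locally uniform limit in \<open>hinf\<close>. Subtracting it
  reduces to sequences tending to 0, so images of bounded sequences have subsequences convergent in
  Bloch norm.\<close>

lemma limits_imp_compact_operator:
  fixes \<phi> :: "complex^'n \<Rightarrow> complex^'n"
  assumes \<phi>: "holomorphic_self_map \<phi>" and \<psi>: "\<psi> \<in> bloch"
    and W: "weighted_comp \<psi> \<phi> ` hinf \<subseteq> bloch"
    and lim1: "lim_to_boundary_zero \<phi> (Q \<psi>)"
    and lim2: "lim_to_boundary_zero \<phi> (\<lambda>z. cmod (\<psi> z) * theta \<phi> z)"
  shows "compact_operator hinf hinf_norm bloch bloch_norm (weighted_comp \<psi> \<phi>)"
  unfolding compact_operator_def
proof (intro conjI ballI allI impI W)
  let ?W = "weighted_comp \<psi> \<phi>"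
  show "?W (\<lambda>x. c * f x + d * g x) = (\<lambda>y. c * ?W f y + d * ?W g y)" for f g c d
    by (simp add: weighted_comp_def fun_eq_iff algebra_simps)
  interpret Metric_space bloch "norm_dist bloch bloch_norm :: (complex^'n \<Rightarrow> complex) \<Rightarrow> _"
    by (rule Metric_space_bloch)
  fix S :: "(complex^'n \<Rightarrow> complex) set" and M :: real assume S: "S \<subseteq> hinf \<and> (\<forall>f\<in>S. hinf_norm f \<le> M)"
  have WS: "?W ` S \<subseteq> bloch" using W S by auto
  have conv: "\<exists>l r. l \<in> bloch \<and> strict_mono r \<and> limitin mtopology (\<sigma> \<circ> r) l sequentially"
    if \<sigma>: "range \<sigma> \<subseteq> ?W ` S" for \<sigma> :: "nat \<Rightarrow> complex^'n \<Rightarrow> complex"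
  proof -
    have "\<forall>m. \<exists>f\<in>S. \<sigma> m = ?W f" using \<sigma> by auto
    then obtain f where f: "\<And>m. f m \<in> S" "\<And>m. \<sigma> m = ?W (f m)" by metis
    have fh: "f m \<in> hinf" and fn: "hinf_norm (f m) \<le> M" for m using S f by auto
    have fM: "cmod (f m z) \<le> M" if "z \<in> polydisk" for m z
      using norm_le_hinf_norm[OF fh that, of m] fn[of m] by linarith
    obtain s g where s: "strict_mono (s :: nat \<Rightarrow> nat)" and g: "holomorphic_polydisk g"
      and gM: "\<And>z. z \<in> polydisk \<Longrightarrow> cmod (g z) \<le> M"
      and ul: "\<And>r. r < 1 \<Longrightarrow> uniform_limit (poly_cball r) (\<lambda>n. f (s n)) g sequentially"
      by (rule Montel_polydisk[of f M]) (use fM hinf_holomorphic[OF fh] in auto)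
    let ?g = "zero_ext g"
    have gh: "?g \<in> hinf" by (rule zero_ext_hinf(1)[OF g gM])
    then have Wg: "?W ?g \<in> bloch" using W by blast
    define p where "p n z = 1 * f (s n) z + (-1) * ?g z" for n z
    have p: "holomorphic_polydisk (p n)" for n
      unfolding p_def[abs_def] by (rule holomorphic_polydisk_lincomb(1)[OF hinf_holomorphic[OF fh] hinf_holomorphic[OF gh]])
    have pM: "cmod (p n z) \<le> M + M" if "z \<in> polydisk" for n z
      using norm_triangle_ineq4[of "f (s n) z" "g z"] fM[OF that, of "s n"] gM[OF that] that
      by (simp add: p_def)
    have pul: "uniform_limit (poly_cball r) p (\<lambda>_. 0) sequentially" if r: "r < 1" for r
    proof -
      have "poly_cball r \<subseteq> (polydisk :: (complex^'n) set)" by (rule poly_cball_subset[OF r])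
      then show ?thesis
        using ul[OF r] by (simp add: uniform_limit_iff p_def dist_norm subset_iff)
    qed
    have "limitin mtopology (\<sigma> \<circ> s) (?W ?g) sequentially"
      unfolding limitin_metric
    proof (intro conjI allI impI Wg)
      fix \<epsilon> :: real assume e: "\<epsilon> > 0"
      have \<sigma>b: "\<sigma> (s n) \<in> bloch" for n using \<sigma> WS by auto
      have "(\<lambda>z. \<sigma> (s n) z - ?W ?g z) = ?W (p n)" for n
        by (simp add: f(2) weighted_comp_def p_def fun_eq_iff algebra_simps)
      then show "\<forall>\<^sub>F n in sequentially. (\<sigma> \<circ> s) n \<in> bloch \<and>
          norm_dist bloch bloch_norm ((\<sigma> \<circ> s) n) (?W ?g) < \<epsilon>"
        using weighted_comp_bloch_norm_tendsto_0[OF \<phi> \<psi> W lim1 lim2 p pM pul e] \<sigma>b Wg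
        by (simp add: norm_dist_def)
    qed
    then show ?thesis using Wg s by (intro exI[of _ "?W ?g"] exI[of _ s] conjI)
  qed
  show "compactin (norm_topology bloch bloch_norm) (norm_topology bloch bloch_norm closure_of (?W ` S))"
    unfolding norm_topology_def compact_closure_of_eq_Bolzano_Weierstrass
  proof (intro allI impI)
    fix T assume T: "infinite T \<and> T \<subseteq> ?W ` S \<and> T \<subseteq> bloch"
    \<comment> \<open>The subsequence property \<open>conv\<close> is converted to existence of
      limit points, the form in which compactness of the closure is characterised.\<close>
    have "\<forall>T. T \<subseteq> ?W ` S \<and> infinite T \<longrightarrow> bloch \<inter> mtopology derived_set_of T \<noteq> {}"
      by (rule iffD1[OF Bolzano_Weierstrass_property[OF WS WS]]) (intro allI impI conv)
    then have "bloch \<inter> mtopology derived_set_of T \<noteq> {}" using T by simp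
    then show "mtopology derived_set_of T \<noteq> {}" by auto
  qed
qed

text \<open>The inclusion assumption expresses that the operator is taken as a map from the bounded
  holomorphic functions into the Bloch space.\<close>

theorem theorem4p7:
  fixes \<phi> :: "complex^'n \<Rightarrow> complex^'n" and \<psi> :: "complex^'n \<Rightarrow> complex"
  assumes "holomorphic_self_map \<phi>" and "\<psi> \<in> bloch"
    and "weighted_comp \<psi> \<phi> ` hinf \<subseteq> bloch"
  shows "compact_operator hinf hinf_norm bloch bloch_norm (weighted_comp \<psi> \<phi>) \<longleftrightarrow>
    lim_to_boundary_zero \<phi> (Q \<psi>) \<and>
    lim_to_boundary_zero \<phi> (\<lambda>z. cmod (\<psi> z) * theta \<phi> z)"
  using compact_operator_imp_limits[OF _ assms(1,2)] limits_imp_compact_operator[OF assms] by metis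

end
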